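(* Let $\nu\in\mathcal{BID}$ be compactly supported, let $\{\nu_t\}_{t\ge0}$ be the $\boxplus\boxplus$-semigroup generated by $\nu$, and write $G(t,z,w)=G_{\nu_t}(z,w)$. Then there is $r>0$ such that $R_\nu$ is given by an absolutely convergent power series in the bidisk $\Omega=\{(z,w)\in\mathbb{C}^2:|z|<r,|w|<r\}$ and, with $\Omega^*=\Omega\setminus\{(0,0)\}$, the right-derivative $$\lim_{t\to0^+}\frac{G(t,1/z,1/w)-G(0,1/z,1/w)}{t}=zw\,R_\nu(z,w)$$ exists and has this value for every $(z,w)\in\Omega^*$.
   Context: For a Borel probability measure $\mu$ on $\mathbb{R}^2$, its marginals are $\mu^{(j)}=\mu\circ\pi_j^{-1}$, $j=1,2$, where $\pi_1(s,t)=s$, $\pi_2(s,t)=t$, and its Cauchy transform is $G_\mu(z,w)=\int_{\mathbb{R}^2}\frac{1}{(z-s)(w-t)}\,d\mu(s,t)$ for $z,w\in\mathbb{C}\setminus\mathbb{R}$; for compactly supported $\mu$ the same formula is used for all $z,w$ with $|z|,|w|$ large enough. In particular $G_\mu(1/z,1/w)=\int_{\mathbb{R}^2}\frac{zw}{(1-zs)(1-wt)}\,d\mu(s,t)$ for $z,w$ near $0$, the right-hand side being used as the value of $G_\mu(1/z,1/w)$ also when $z=0$ or $w=0$. For a probability measure $m$ on $\mathbb{R}$, $G_m(z)=\int_{\mathbb{R}}\frac{1}{z-x}\,dm(x)$, $z\notin\mathbb{R}$. For $\alpha,\beta>0$ the Stolz angle is $\Delta=\Delta_{\alpha,\beta}=\{x+iy\in\mathbb{C}: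 y<0,\ |x|<-\alpha y,\ y>-\beta\}$, $\overline{\Delta}=\{\bar z:z\in\Delta\}$ is its reflection, and the associated product domain is $(\Delta\cup\overline\Delta)\times(\Delta\cup\overline\Delta)$. The one-dimensional $R$-transform $R_m$ of a probability measure $m$ on $\mathbb{R}$ is the holomorphic function on $\Delta\cup\overline\Delta$ (for a sufficiently small Stolz angle $\Delta$) with $1/z+R_m(z)\notin\mathbb{R}$, $G_m(1/z+R_m(z))=z$, and $zR_m(z)\to0$ as $z\to0$ in $\Delta\cup\overline\Delta$. The bi-free partial $R$-transform of a probability measure $\mu$ on $\mathbb{R}^2$ is $$R_\mu(z,w)=zR_{\mu^{(1)}}(z)+wR_{\mu^{(2)}}(w)+\left[1-\frac{1}{h_\mu(z,w)}\right],\quad h_\mu(z,w)=\frac{G_\mu\left(1/z+R_{\mu^{(1)}}(z),\,1/w+R_{\mu^{(2)}}(w)\right)}{zw},$$ which is defined and holomorphic on a product domain (with $\Delta$ small enough) on which $R_{\mu^{(1)}},R_{\mu^{(2)}}$ are defined and $h_\mu$ has no zeros. If $\mu$ is compactly supported, $R_\mu$ extends holomorphically to a bidisk centered at $(0,0)$, where it has an absolutely convergent power series expansion with real coefficients. $\mathcal{BID}$ is the class of bi-freely infinitely divisible laws: probability measures $\nu$ on $\mathbb{R}^2$ such that for each integer $m\ge2$ there is a probability measure $\mu_m$ on $\mathbb{R}^2$ with $R_\nu=mR_{\mu_m}$ on the (product) domain of $R_\nu$. For $\nu\in\mathcal{BID}$, $R_\nu$ extends holomorphically to $(\mathbb{C}\setminus\mathbb{R})^2$,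 and the extension is still denoted $R_\nu$. The $\boxplus\boxplus$-semigroup generated by $\nu\in\mathcal{BID}$ is the family $\{\nu_t\}_{t\ge0}\subset\mathcal{BID}$ determined by $R_{\nu_t}=tR_\nu$ in $(\mathbb{C}\setminus\mathbb{R})^2$ (so $\nu_0=\delta_{(0,0)}$, $\nu_1=\nu$). *)

theory Defs
  imports "HOL-Probability.Probability" "HOL-Complex_Analysis.Complex_Analysis"
begin

section \<open>Probability measures on the plane and Cauchy transforms\<close>

definition plane_law :: "(real \<times> real) measure \<Rightarrow> bool" where
  "plane_law \<mu> \<longleftrightarrow> prob_space \<mu> \<and> sets \<mu> = sets borel"

definition compactly_supported :: "(real \<times> real) measure \<Rightarrow> bool" where
  "compactly_supported \<mu> \<longleftrightarrow> (\<exists>K. compact K \<and> emeasure \<mu> (UNIV - K) = 0)"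

definition marginal1 :: "(real \<times> real) measure \<Rightarrow> real measure" where
  "marginal1 \<mu> = distr \<mu> borel fst"

definition marginal2 :: "(real \<times> real) measure \<Rightarrow> real measure" where
  "marginal2 \<mu> = distr \<mu> borel snd"

definition cauchy1 :: "real measure \<Rightarrow> complex \<Rightarrow> complex" where
  "cauchy1 m z = (LINT x|m. 1 / (z - of_real x))"

definition cauchy2 :: "(real \<times> real) measure \<Rightarrow> complex \<Rightarrow> complex \<Rightarrow> complex" where
  "cauchy2 \<mu> z w =
     (LINT (s, t)|\<mu>. 1 / ((z - of_real s) * (w - of_real t)))"

text \<open>
  The value of the Cauchy transform at \<open>(1/z, 1/w)\<close>. Writing the integrand without
  \<open>1/z\<close> and \<open>1/w\<close> makes it meaningful for \<open>z = 0\<close> or \<open>w = 0\<close> as well (where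
  \<open>cauchy2 \<mu> (1/z) (1/w)\<close> would be an artefact of division by zero); see
  \<open>cauchy2_inv_eq\<close> for the other points.
\<close>

definition cauchy2_inv_integrand ::
    "complex \<Rightarrow> complex \<Rightarrow> real \<times> real \<Rightarrow> complex" where
  "cauchy2_inv_integrand z w =
     (\<lambda>(s, t). z * w / ((1 - z * of_real s) * (1 - w * of_real t)))"

definition cauchy2_inv :: "(real \<times> real) measure \<Rightarrow> complex \<Rightarrow> complex \<Rightarrow> complex" where
  "cauchy2_inv \<mu> z w = (LINT p|\<mu>. cauchy2_inv_integrand z w p)"

lemma cauchy2_inv_eq:
  assumes "z \<noteq> 0" "w \<noteq> 0"
  shows "cauchy2_inv \<mu> z w = cauchy2 \<mu> (1 / z) (1 / w)"
proof -
  have "z * w / ((1 - z * a) * (1 - w * b)) = 1 / ((1 / z - a) * (1 / w - b))" for a b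
  proof -
    have "(1 - z * a) * (1 - w * b) = z * w * ((1 / z - a) * (1 / w - b))"
      using assms by (simp add: field_simps)
    then show ?thesis using assms by simp
  qed
  then show ?thesis
    by (simp add: cauchy2_inv_def cauchy2_inv_integrand_def cauchy2_def)
qed


section \<open>Stolz angles and R-transforms\<close>

definition stolz :: "real \<Rightarrow> real \<Rightarrow> complex set" where
  "stolz \<alpha> \<beta> = {z. Im z < 0 \<and> \<bar>Re z\<bar> < - \<alpha> * Im z \<and> Im z > - \<beta>}"

definition stolz_sym :: "real \<Rightarrow> real \<Rightarrow> complex set" where
  "stolz_sym \<alpha> \<beta> = stolz \<alpha> \<beta> \<union> cnj ` stolz \<alpha> \<beta>"

definition R_transform_on ::
    "real measure \<Rightarrow> real \<Rightarrow> real \<Rightarrow> (complex \<Rightarrow> complex) \<Rightarrow> bool" where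
  "R_transform_on m \<alpha> \<beta> R \<longleftrightarrow>
     R holomorphic_on stolz_sym \<alpha> \<beta> \<and>
     (\<forall>z\<in>stolz_sym \<alpha> \<beta>. 1 / z + R z \<notin> \<real> \<and> cauchy1 m (1 / z + R z) = z) \<and>
     ((\<lambda>z. z * R z) \<longlongrightarrow> 0) (at 0 within stolz_sym \<alpha> \<beta>)"

definition h_bifree ::
    "(real \<times> real) measure \<Rightarrow> (complex \<Rightarrow> complex) \<Rightarrow> (complex \<Rightarrow> complex)
      \<Rightarrow> complex \<Rightarrow> complex \<Rightarrow> complex" where
  "h_bifree \<mu> R1 R2 z w = cauchy2 \<mu> (1 / z + R1 z) (1 / w + R2 w) / (z * w)"

text \<open>
  \<open>R\<close> is the bi-free partial R-transform of \<open>\<mu>\<close> on the product domain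
  \<open>stolz_sym \<alpha> \<beta> \<times> stolz_sym \<alpha> \<beta>\<close>; the values of \<open>R\<close> elsewhere are unconstrained.
\<close>

definition bifree_R_on ::
    "(real \<times> real) measure \<Rightarrow> real \<Rightarrow> real \<Rightarrow> (complex \<Rightarrow> complex \<Rightarrow> complex) \<Rightarrow> bool" where
  "bifree_R_on \<mu> \<alpha> \<beta> R \<longleftrightarrow>
     (\<exists>R1 R2. R_transform_on (marginal1 \<mu>) \<alpha> \<beta> R1 \<and>
              R_transform_on (marginal2 \<mu>) \<alpha> \<beta> R2 \<and>
              (\<forall>z\<in>stolz_sym \<alpha> \<beta>. \<forall>w\<in>stolz_sym \<alpha> \<beta>.
                 h_bifree \<mu> R1 R2 z w \<noteq> 0 \<and>
                 R z w = z * R1 z + w * R2 w + (1 - 1 / h_bifree \<mu> R1 R2 z w)))"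


section \<open>Bi-free infinite divisibility\<close>

definition BID :: "(real \<times> real) measure set" where
  "BID = {\<nu>. plane_law \<nu> \<and>
     (\<exists>\<alpha>>0. \<exists>\<beta>>0. \<exists>R. bifree_R_on \<nu> \<alpha> \<beta> R \<and>
       (\<forall>m::nat. m \<ge> 2 \<longrightarrow>
          (\<exists>\<mu> R'. plane_law \<mu> \<and> bifree_R_on \<mu> \<alpha> \<beta> R' \<and>
             (\<forall>z\<in>stolz_sym \<alpha> \<beta>. \<forall>w\<in>stolz_sym \<alpha> \<beta>. R z w = of_nat m * R' z w))))}"

text \<open>Holomorphy in two variables: the real derivative exists and is complex linear.\<close>

definition holomorphic2_on ::
    "(complex \<Rightarrow> complex \<Rightarrow> complex) \<Rightarrow> (complex \<times> complex) set \<Rightarrow> bool" where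
  "holomorphic2_on f S \<longleftrightarrow>
     (\<forall>p\<in>S. \<exists>a b. ((\<lambda>(z, w). f z w) has_derivative (\<lambda>(h, k). a * h + b * k)) (at p within S))"

text \<open>
  \<open>R\<close> is the holomorphic extension of the bi-free R-transform of \<open>\<mu>\<close> to
  \<open>(\<complex> - \<real>)\<^sup>2\<close>. Every product domain meets all four components of this set, so \<open>R\<close> is
  uniquely determined there.
\<close>

definition bifree_R_ext ::
    "(real \<times> real) measure \<Rightarrow> (complex \<Rightarrow> complex \<Rightarrow> complex) \<Rightarrow> bool" where
  "bifree_R_ext \<mu> R \<longleftrightarrow>
     holomorphic2_on R ((- \<real>) \<times> (- \<real>)) \<and> (\<exists>\<alpha>>0. \<exists>\<beta>>0. bifree_R_on \<mu> \<alpha> \<beta> R)"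

definition bifree_semigroup ::
    "(real \<times> real) measure \<Rightarrow> (real \<Rightarrow> (real \<times> real) measure) \<Rightarrow> bool" where
  "bifree_semigroup \<nu> \<nu>t \<longleftrightarrow>
     (\<exists>R. bifree_R_ext \<nu> R \<and>
       (\<forall>t\<ge>0. \<nu>t t \<in> BID \<and> bifree_R_ext (\<nu>t t) (\<lambda>z w. of_real t * R z w)))"

end

theory Submission
  imports Defs "HOL-Real_Asymp.Real_Asymp"
begin

text \<open>
  For the compactly supported \<open>\<nu>\<close>, the marginal R-transforms \<open>r1\<close>, \<open>r2\<close> and the bi-free
  R-transform \<open>P\<close> are holomorphic near the origin. Letting one variable of \<open>t P\<close> tend to 0 shows
  that \<open>\<nu>t t\<close> has marginal R-transforms \<open>t r1\<close> and \<open>t r2\<close>; by Stieltjes inversion the \<open>\<nu>t t\<close>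
  with \<open>t \<le> 1\<close> then have a common compact support. With \<open>a = 1 + t z r1 z\<close>,
  \<open>b = 1 + t w r2 w\<close> and \<open>E t (z, w) = \<integral> 1 / ((1 - z s) (1 - w u)) d(\<nu>t t)\<close>, the definition of the
  bi-free R-transform reads \<open>E t (z / a, w / b) (1 + t (z r1 z + w r2 w - P z w)) = a b\<close> on a fixed
  bidisk. Hence \<open>E t = 1 + t P + o(t)\<close> there, and the Cauchy transform at \<open>(1/z, 1/w)\<close> is \<open>z w E t\<close>.
\<close>

subsection \<open>Lebesgue integrals depending holomorphically on a parameter\<close>

text \<open>Each \<open>\<nu>t t\<close> is known only through a bi-free R-transform on some product
  domain; the size of that domain and the marginal transforms are existentially quantified and may
  vary with \<open>t\<close>, and compact support of \<open>\<nu>t t\<close> is not given. The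
  derivative at \<open>t = 0\<close> needs one bidisk that serves all small \<open>t\<close>. Two
  devices supply it. The marginal transforms are read off from the two-variable function alone, by a
  limit along the imaginary axis that works without moments. The support bound depends only on
  \<open>r1\<close> and \<open>r2\<close> and is uniform for \<open>t \<le> 1\<close>, so all
  integrals are holomorphic on one bidisk, and the identity theorem carries the relation there from
  the \<open>t\<close>-dependent angles. For \<open>P\<close>, separate holomorphy and a bound are
  enough: Cauchy estimates turn them into continuity and into the double series. The constant 1/16
  keeps each factor such as \<open>a - z s\<close> within 1/8 of 1, hence the kernel and its
  integral within 1/2 of 1.\<close>

lemma norm_diff_le_of_holomorphic_bounded:
  fixes f :: "complex \<Rightarrow> complex"
  assumes hol: "f holomorphic_on ball z d" and d: "d > 0"
    and B: "\<And>w. w \<in> ball z d \<Longrightarrow> norm (f w) \<le> B"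
    and w: "w \<in> ball z (d/2)" "w' \<in> ball z (d/2)"
  shows "norm (f w - f w') \<le> 4 * B / d * norm (w - w')"
proof (rule field_differentiable_bound[of "ball z (d/2)" f "deriv f"])
  fix u assume u: "u \<in> ball z (d/2)"
  \<comment> \<open>A point of the half ball is at distance more than \<open>d/4\<close> from the
    boundary of the full ball, so Cauchy's estimate with radius \<open>d/4\<close> applies and
    yields the factor \<open>4 / d\<close>.\<close>
  have sub: "cball u (d/4) \<subseteq> ball z d"
  proof
    fix v assume "v \<in> cball u (d/4)"
    then show "v \<in> ball z d" using u d dist_triangle[of z v u] by auto
  qed
  have "u \<in> ball z d" using u d by auto
  then show "(f has_field_derivative deriv f u) (at u within ball z (d/2))"
    using hol holomorphic_derivI[OF hol] by (meson has_field_derivative_at_within open_ball)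
  have "norm ((deriv ^^ 1) f u) \<le> fact 1 * B / (d/4) ^ 1"
  proof (rule Cauchy_inequality)
    show "f holomorphic_on ball u (d/4)"
      using hol sub by (meson ball_subset_cball holomorphic_on_subset)
    show "continuous_on (cball u (d/4)) f"
      using hol sub by (meson holomorphic_on_imp_continuous_on holomorphic_on_subset)
    show "norm (f x) \<le> B" if "norm (u - x) = d/4" for x
      using sub that by (intro B) (auto simp: subset_iff dist_norm)
  qed (use d in auto)
  then show "norm (deriv f u) \<le> 4 * B / d" by (simp add: field_simps)
qed (use w in auto)

text \<open>The difference quotients of \<open>f x\<close> at \<open>z\<close> are bounded by
  \<open>4 * B / d\<close> uniformly in \<open>x\<close>, so dominated convergence differentiates
  under the integral. Holomorphy and bounds are asked for only on a set \<open>K\<close> of full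
  measure, such as a support.\<close>

lemma holomorphic_on_lebesgue_integral:
  fixes f :: "'a \<Rightarrow> complex \<Rightarrow> complex"
  assumes fin: "finite_measure M" and S: "open S"
    and K: "AE x in M. x \<in> K"
    and meas: "\<And>z. z \<in> S \<Longrightarrow> (\<lambda>x. f x z) \<in> borel_measurable M"
    and hol: "\<And>x. x \<in> K \<Longrightarrow> f x holomorphic_on S"
    and bdd: "\<And>z. z \<in> S \<Longrightarrow>
      \<exists>d>0. \<exists>B. ball z d \<subseteq> S \<and> (\<forall>x\<in>K. \<forall>w\<in>ball z d. norm (f x w) \<le> B)"
  shows "(\<lambda>z. LINT x|M. f x z) holomorphic_on S"
proof -
  interpret finite_measure M by fact
  have "(\<lambda>z. LINT x|M. f x z) field_differentiable at z" if z: "z \<in> S" for z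
  proof -
    obtain d B where d: "d > 0" and sub: "ball z d \<subseteq> S"
      and B: "\<And>x w. x \<in> K \<Longrightarrow> w \<in> ball z d \<Longrightarrow> norm (f x w) \<le> B"
      using bdd[OF z] by blast
    have intg: "integrable M (\<lambda>x. f x w)" if "w \<in> ball z d" for w
    proof (rule integrable_const_bound)
      show "AE x in M. norm (f x w) \<le> B" using K B that by (auto elim: eventually_mono)
    qed (use meas that sub in auto)
    \<comment> \<open>The candidate derivative \<open>D\<close> is a limit along one fixed sequence,
      which makes it measurable in \<open>x\<close>; on \<open>K\<close> it equals
      \<open>deriv (f x) z\<close>. The shift by 3 keeps the sequence inside the half ball.\<close>
    define q where "q = (\<lambda>n x. (f x (z + of_real (d / (real n + 3))) - f x z)
        / of_real (d / (real n + 3)))"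
    define D where "D = (\<lambda>x. lim (\<lambda>n. q n x))"
    have inb: "z + of_real (d / (real n + 3)) \<in> ball z (d/2)" for n
      using d by (simp add: dist_norm del: of_real_divide of_real_add) (simp add: divide_simps)
    have inb': "z + of_real (d / (real n + 3)) \<in> ball z d" for n
      using inb[of n] d by auto
    have Dmeas: "D \<in> borel_measurable M"
      unfolding D_def q_def
      by (intro borel_measurable_lim_metric borel_measurable_divide borel_measurable_diff meas
          borel_measurable_const) (use sub inb' z in auto)
    have der: "((\<lambda>y. (f x y - f x z) / (y - z)) \<longlongrightarrow> D x) (at z)" if x: "x \<in> K" for x
    proof -
      have "(f x has_field_derivative deriv (f x) z) (at z)"
        using hol[OF x] z S by (simp add: holomorphic_derivI)
      then have l: "((\<lambda>y. (f x y - f x z) / (y - z)) \<longlongrightarrow> deriv (f x) z) (at z)"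
        by (simp add: has_field_derivative_iff)
      have t0: "(\<lambda>n. d / (real n + 3)) \<longlonglongrightarrow> 0" by real_asymp
      have t: "(\<lambda>n. z + of_real (d / (real n + 3))) \<longlonglongrightarrow> z"
        using tendsto_add[OF tendsto_const tendsto_of_real[OF t0], of z] by simp
      have nz: "z + of_real (d / (real n + 3)) \<noteq> z" for n
        using d by (simp del: of_real_divide of_real_add add: add_nonneg_eq_0_iff)
      have "(\<lambda>n. q n x) \<longlonglongrightarrow> deriv (f x) z"
        using tendsto_compose_eventually[OF l t eventuallyI[OF nz]]
        unfolding q_def by (simp only: add_diff_cancel_left')
      then have "D x = deriv (f x) z" unfolding D_def by (rule limI)
      then show ?thesis using l by simp
    qed
    have "((\<lambda>y. ((LINT x|M. f x y) - (LINT x|M. f x z)) / (y - z)) \<longlongrightarrow> (LINT x|M. D x))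
        (at z within ball z (d/2))"
      unfolding tendsto_at_iff_sequentially
    proof safe
      fix X :: "nat \<Rightarrow> complex"
      assume X: "\<forall>i. X i \<in> ball z (d/2) - {z}" and lim: "X \<longlonglongrightarrow> z"
      have Xb: "X i \<in> ball z d" for i using X d by (auto dest: spec[of _ i])
      have "(\<lambda>i. LINT x|M. (f x (X i) - f x z) / (X i - z)) \<longlonglongrightarrow> (LINT x|M. D x)"
      proof (rule integral_dominated_convergence)
        show "D \<in> borel_measurable M" by (rule Dmeas)
        show "(\<lambda>x. (f x (X i) - f x z) / (X i - z)) \<in> borel_measurable M" for i
          by (intro borel_measurable_divide borel_measurable_diff meas borel_measurable_const)
             (use sub Xb z in auto)
        show "integrable M (\<lambda>_. 4 * B / d)" by simp
        show "AE x in M. (\<lambda>i. (f x (X i) - f x z) / (X i - z)) \<longlonglongrightarrow> D x"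
          using K
        proof eventually_elim
          case (elim x)
          show ?case
            using tendsto_compose_eventually[OF der[OF elim] lim] X by (auto simp: eventually_sequentially)
        qed
        show "AE x in M. norm ((f x (X i) - f x z) / (X i - z)) \<le> 4 * B / d" for i
          using K
        proof eventually_elim
          case (elim x)
          have "norm (f x (X i) - f x z) \<le> 4 * B / d * norm (X i - z)"
            using X d
            by (intro norm_diff_le_of_holomorphic_bounded[OF holomorphic_on_subset[OF hol[OF elim] sub]]
                B elim) auto
          moreover have "X i \<noteq> z" using X by auto
          ultimately show ?case by (simp add: norm_divide divide_le_eq)
        qed
      qed
      moreover have "(LINT x|M. (f x (X i) - f x z) / (X i - z))
          = ((LINT x|M. f x (X i)) - (LINT x|M. f x z)) / (X i - z)" for i
        using intg[OF Xb] intg[of z] d by (simp only: integral_divide_zero Bochner_Integration.integral_diff centre_in_ball)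
      ultimately show "((\<lambda>y. ((LINT x|M. f x y) - (LINT x|M. f x z)) / (y - z)) \<circ> X)
          \<longlonglongrightarrow> (LINT x|M. D x)"
        by (simp only: o_def)
    qed
    then have "((\<lambda>z. LINT x|M. f x z) has_field_derivative (LINT x|M. D x)) (at z within ball z (d/2))"
      by (simp add: has_field_derivative_iff)
    then show ?thesis
      using d by (metis at_within_open centre_in_ball field_differentiable_def half_gt_zero open_ball)
  qed
  then show ?thesis using S by (simp add: holomorphic_on_open field_differentiable_def)
qed

subsection \<open>Stieltjes inversion\<close>

lemma integrable_cauchy_kernel:
  assumes "real_distribution m" "Im \<zeta> \<noteq> 0"
  shows "integrable m (\<lambda>s. 1 / (\<zeta> - of_real s))"
proof -
  interpret real_distribution m by fact
  show ?thesis
  proof (rule integrable_const_bound)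
    show "AE s in m. norm (1 / (\<zeta> - of_real s)) \<le> 1 / \<bar>Im \<zeta>\<bar>"
    proof (rule AE_I2)
      fix s
      have "\<bar>Im \<zeta>\<bar> \<le> norm (\<zeta> - of_real s)" using abs_Im_le_cmod[of "\<zeta> - of_real s"] by simp
      then show "norm (1 / (\<zeta> - of_real s)) \<le> 1 / \<bar>Im \<zeta>\<bar>"
        using assms(2) by (simp add: norm_divide frac_le)
    qed
  qed simp
qed

text \<open>\<open>- Im (1 / (x + i y - s))\<close> is the Poisson kernel
  \<open>y / ((x - s)^2 + y^2)\<close> up to a constant factor; it is nonnegative, and at least
  \<open>1 / (2 y)\<close> when \<open>s\<close> is within \<open>y\<close> of
  \<open>x\<close>.\<close>

lemma measure_interval_le_cauchy1:
  assumes "real_distribution m" and y: "y > 0"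
  shows "measure m {x - y..x + y} \<le> 2 * y * - Im (cauchy1 m (Complex x y))"
proof -
  interpret real_distribution m by fact
  have int: "integrable m (\<lambda>s. 1 / (Complex x y - of_real s))"
    by (rule integrable_cauchy_kernel) (use y assms in auto)
  have "measure m {x - y..x + y} = (LINT s|m. indicator {x - y..x + y} s)" by simp
  also have "\<dots> \<le> (LINT s|m. 2 * y * - Im (1 / (Complex x y - of_real s)))"
  proof (rule integral_mono)
    fix s
    show "indicator {x - y..x + y} s \<le> 2 * y * - Im (1 / (Complex x y - of_real s))"
    proof (cases "s \<in> {x - y..x + y}")
      case True
      then have "(x - s)\<^sup>2 \<le> y\<^sup>2" using y by (intro abs_le_square_iff[THEN iffD1]) auto
      moreover have "0 < (x - s)\<^sup>2 + y\<^sup>2" using y by (simp add: add_nonneg_pos)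
      ultimately have "1 \<le> 2 * y * (y / ((x - s)\<^sup>2 + y\<^sup>2))"
        using y by (simp add: field_simps power2_eq_square)
      then show ?thesis using True by (simp add: Im_divide)
    next
      case False
      then show ?thesis using y by (simp add: Im_divide)
    qed
  qed (use int in \<open>auto intro!: integrable_Im integrable_mult_right integrable_minus
         simp del: Im_divide simp: integrable_indicator_iff emeasure_eq_measure\<close>)
  also have "\<dots> = 2 * y * - Im (cauchy1 m (Complex x y))"
    unfolding cauchy1_def using int by (simp flip: integral_Im)
  finally show ?thesis .
qed

text \<open>The increment of the cdf over \<open>h\<close> is at most the mass of the interval of
  radius \<open>\<bar>h\<bar>\<close> around \<open>x\<close>. Choosing the height
  \<open>y = \<bar>h\<bar>\<close> in the preceding estimate cancels the \<open>h\<close> of the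
  difference quotient.\<close>

lemma cdf_has_derivative_zero:
  assumes m: "real_distribution m"
    and lim: "((\<lambda>y. Im (cauchy1 m (Complex x y))) \<longlongrightarrow> 0) (at_right 0)"
  shows "(cdf m has_field_derivative 0) (at x)"
proof -
  interpret real_distribution m by fact
  have le: "norm ((cdf m (x + h) - cdf m x) / h) \<le> 2 * \<bar>Im (cauchy1 m (Complex x \<bar>h\<bar>))\<bar>"
    if h: "h \<noteq> 0" for h
  proof -
    have "\<bar>cdf m (x + h) - cdf m x\<bar> \<le> measure m {x - \<bar>h\<bar>..x + \<bar>h\<bar>}"
    proof (cases "h > 0")
      case True
      then have "\<bar>cdf m (x + h) - cdf m x\<bar> = measure m {x<..x + h}" by (simp flip: cdf_diff_eq add: cdf_nondecreasing)
      also have "\<dots> \<le> measure m {x - \<bar>h\<bar>..x + \<bar>h\<bar>}" using True by (intro finite_measure_mono) auto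
      finally show ?thesis .
    next
      case False
      with h have "h < 0" by simp
      then have "\<bar>cdf m (x + h) - cdf m x\<bar> = measure m {x + h<..x}" by (simp flip: cdf_diff_eq add: cdf_nondecreasing)
      also have "\<dots> \<le> measure m {x - \<bar>h\<bar>..x + \<bar>h\<bar>}" using \<open>h < 0\<close> by (intro finite_measure_mono) auto
      finally show ?thesis .
    qed
    also have "\<dots> \<le> 2 * \<bar>h\<bar> * - Im (cauchy1 m (Complex x \<bar>h\<bar>))"
      by (rule measure_interval_le_cauchy1) (use h m in auto)
    also have "\<dots> \<le> 2 * \<bar>h\<bar> * \<bar>Im (cauchy1 m (Complex x \<bar>h\<bar>))\<bar>"
      by (intro mult_left_mono) auto
    finally show ?thesis using h by (simp add: divide_le_eq mult_ac)
  qed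
  have "filterlim abs (at_right 0) (at (0::real))"
    unfolding filterlim_at by (auto intro!: tendsto_eq_intros simp: eventually_at_filter)
  then have "((\<lambda>h. 2 * \<bar>Im (cauchy1 m (Complex x \<bar>h\<bar>))\<bar>) \<longlongrightarrow> 0) (at 0)"
    by (intro tendsto_mult_right_zero tendsto_rabs_zero filterlim_compose[OF lim])
  moreover have "eventually (\<lambda>h. norm ((cdf m (x + h) - cdf m x) / h)
      \<le> 2 * \<bar>Im (cauchy1 m (Complex x \<bar>h\<bar>))\<bar>) (at 0)"
    using le by (auto simp: eventually_at_filter)
  ultimately have "((\<lambda>h. (cdf m (x + h) - cdf m x) / h) \<longlongrightarrow> 0) (at 0)"
    by (rule Lim_null_comparison[rotated])
  then show ?thesis by (simp add: DERIV_def)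
qed

text \<open>Zero derivative makes the cdf constant on the two half-lines beyond \<open>M\<close> and
  \<open>-M\<close>; its limits at infinity identify the constants as 1 and 0. The strict
  \<open>M < M'\<close> puts the cut points inside these half-lines.\<close>

lemma AE_bounded_of_cauchy1:
  assumes m: "real_distribution m" and "M < M'"
    and lim: "\<And>x. \<bar>x\<bar> > M \<Longrightarrow> ((\<lambda>y. Im (cauchy1 m (Complex x y))) \<longlongrightarrow> 0) (at_right 0)"
  shows "AE x in m. \<bar>x\<bar> \<le> M'"
proof -
  interpret real_distribution m by fact
  have D: "(cdf m has_field_derivative 0) (at x within S)" if "\<bar>x\<bar> > M" for x S
    using cdf_has_derivative_zero[OF m lim[OF that]] has_field_derivative_at_within by blast
  obtain c where c: "\<And>x. x \<in> {M<..} \<Longrightarrow> cdf m x = c"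
    using has_field_derivative_zero_constant[of "{M<..}" "cdf m"] D by force
  obtain c' where c': "\<And>x. x \<in> {..<-M} \<Longrightarrow> cdf m x = c'"
    using has_field_derivative_zero_constant[of "{..<-M}" "cdf m"] D by force
  have "eventually (\<lambda>x. cdf m x = c) at_top"
    using eventually_gt_at_top[of M] by eventually_elim (use c in auto)
  then have "(cdf m \<longlongrightarrow> c) at_top" by (rule tendsto_eventually)
  then have "c = 1"
    using tendsto_unique[OF trivial_limit_at_top_linorder _ cdf_lim_at_top_prob] by blast
  have "eventually (\<lambda>x. cdf m x = c') at_bot"
    using eventually_gt_at_bot[of "-M"] by eventually_elim (use c' in auto)
  then have "(cdf m \<longlongrightarrow> c') at_bot" by (rule tendsto_eventually)
  then have "c' = 0"
    using tendsto_unique[OF trivial_limit_at_bot_linorder _ cdf_lim_at_bot] by blast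
  have "prob {..M'} = 1" using c[of M'] \<open>c = 1\<close> assms by (simp add: cdf_def)
  then have "AE x in m. x \<in> {..M'}" by (subst AE_in_set_eq_1) auto
  moreover have "prob {..- M'} = 0" using c'[of "-M'"] \<open>c' = 0\<close> assms by (simp add: cdf_def)
  then have "AE x in m. x \<notin> {..- M'}" using prob_eq_0[of "{..-M'}"] by auto
  ultimately show ?thesis by eventually_elim auto
qed

subsection \<open>Double power series\<close>

text \<open>Cauchy's inequality on the circle of radius \<open>\<sigma>\<close> bounds the
  coefficients, and the Taylor tail is then dominated by a geometric series in
  \<open>norm z / \<sigma>\<close>.\<close>

lemma Taylor_remainder_bound:
  fixes f :: "complex \<Rightarrow> complex"
  assumes hol: "f holomorphic_on ball 0 \<rho>" and \<sigma>: "0 < \<sigma>" "\<sigma> < \<rho>"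
    and B: "\<And>z. z \<in> ball 0 \<rho> \<Longrightarrow> norm (f z) \<le> B"
  shows Taylor_coeff_bound: "norm ((deriv ^^ n) f 0 / fact n) \<le> B / \<sigma> ^ n"
    and "norm z < \<sigma> \<Longrightarrow> norm (f z - (\<Sum>k<m. (deriv ^^ k) f 0 / fact k * z ^ k))
      \<le> B * (norm z / \<sigma>) ^ m / (1 - norm z / \<sigma>)"
proof -
  have coeff: "norm ((deriv ^^ n) f 0 / fact n) \<le> B / \<sigma> ^ n" for n
  proof -
    have sub: "cball 0 \<sigma> \<subseteq> ball (0::complex) \<rho>" using \<sigma> by auto
    have "norm ((deriv ^^ n) f 0) \<le> fact n * B / \<sigma> ^ n"
    proof (rule Cauchy_inequality)
      show "f holomorphic_on ball 0 \<sigma>"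
        using hol sub by (meson ball_subset_cball holomorphic_on_subset)
      show "continuous_on (cball 0 \<sigma>) f"
        using hol sub by (meson holomorphic_on_imp_continuous_on holomorphic_on_subset)
    qed (use \<sigma> B in auto)
    then show ?thesis by (simp add: norm_divide field_simps)
  qed
  show "norm ((deriv ^^ n) f 0 / fact n) \<le> B / \<sigma> ^ n" by (rule coeff)
  show "norm (f z - (\<Sum>k<m. (deriv ^^ k) f 0 / fact k * z ^ k))
      \<le> B * (norm z / \<sigma>) ^ m / (1 - norm z / \<sigma>)" if z: "norm z < \<sigma>"
  proof -
    have q: "norm z / \<sigma> < 1" "norm z / \<sigma> \<ge> 0" using z \<sigma> by auto
    have "(\<lambda>k. (deriv ^^ k) f 0 / fact k * (z - 0) ^ k) sums f z"
      by (rule holomorphic_power_series[OF hol]) (use z \<sigma> in auto)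
    then have s: "(\<lambda>k. (deriv ^^ k) f 0 / fact k * z ^ k) sums f z" by simp
    have "(\<lambda>k. B * (norm z / \<sigma>) ^ m * (norm z / \<sigma>) ^ k)
        sums (B * (norm z / \<sigma>) ^ m * (1 / (1 - norm z / \<sigma>)))"
      by (intro sums_mult geometric_sums) (use q in auto)
    moreover have "norm ((deriv ^^ (k + m)) f 0 / fact (k + m) * z ^ (k + m))
        \<le> B * (norm z / \<sigma>) ^ m * (norm z / \<sigma>) ^ k" for k
    proof -
      have "norm ((deriv ^^ (k + m)) f 0 / fact (k + m) * z ^ (k + m))
          = norm ((deriv ^^ (k + m)) f 0 / fact (k + m)) * norm z ^ (k + m)"
        by (simp only: norm_mult norm_power)
      also have "\<dots> \<le> B / \<sigma> ^ (k + m) * norm z ^ (k + m)"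
        by (intro mult_right_mono coeff) auto
      also have "\<dots> = B * (norm z / \<sigma>) ^ m * (norm z / \<sigma>) ^ k"
        by (simp add: power_divide power_add mult_ac)
      finally show ?thesis .
    qed
    ultimately show ?thesis
      using norm_sums_le[OF sums_split_initial_segment[OF s, of m]] by simp
  qed
qed

text \<open>The coefficients of the expansion in the first variable are holomorphic in the second one,
  because they are uniform limits of difference quotients built from the preceding ones.\<close>

lemma holomorphic_Taylor_coeff:
  fixes P :: "complex \<Rightarrow> complex \<Rightarrow> complex"
  assumes \<rho>: "\<rho> > 0"
    and holz: "\<And>w. w \<in> ball 0 \<rho> \<Longrightarrow> (\<lambda>z. P z w) holomorphic_on ball 0 \<rho>"
    and holw: "\<And>z. z \<in> ball 0 \<rho> \<Longrightarrow> P z holomorphic_on ball 0 \<rho>"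
    and B: "\<And>z w. z \<in> ball 0 \<rho> \<Longrightarrow> w \<in> ball 0 \<rho> \<Longrightarrow> norm (P z w) \<le> B"
  shows "(\<lambda>w. (deriv ^^ m) (\<lambda>z. P z w) 0 / fact m) holomorphic_on ball 0 \<rho>"
proof (induction m rule: less_induct)
  case (less m)
  define C where "C = (\<lambda>m w. (deriv ^^ m) (\<lambda>z. P z w) 0 / fact m)"
  define \<sigma> where "\<sigma> = \<rho> / 2"
  have \<sigma>: "0 < \<sigma>" "\<sigma> < \<rho>" using \<rho> by (auto simp: \<sigma>_def)
  define x where "x = (\<lambda>n. \<sigma> / (real n + 2))"
  have x: "0 < x n" "x n < \<sigma>" "x n / \<sigma> = 1 / (real n + 2)" for n
    using \<sigma> by (auto simp: x_def divide_simps)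
  \<comment> \<open>Removing the first \<open>m\<close> Taylor terms and dividing by
    \<open>x n ^ m\<close> leaves \<open>C m w + O(x n)\<close>, and the choice of
    \<open>x n\<close> makes the error a multiple of \<open>1 / (n + 1)\<close>, uniformly in
    \<open>w\<close>. Only \<open>C k\<close> with \<open>k < m\<close> occur, so the induction
    hypothesis makes \<open>F n\<close> holomorphic.\<close>
  define F where "F = (\<lambda>n w. (P (of_real (x n)) w - (\<Sum>k<m. C k w * of_real (x n) ^ k)) / of_real (x n) ^ m)"
  have F: "F n holomorphic_on ball 0 \<rho>" for n
    unfolding F_def using x[of n] \<sigma> less.IH
    by (intro holomorphic_intros holw) (auto simp: C_def)
  have bound: "norm (F n w - C m w) \<le> B / \<sigma> ^ m / (real n + 1)" if w: "w \<in> ball 0 \<rho>" for n w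
  proof -
    let ?z = "of_real (x n) :: complex"
    have "norm (P ?z w - (\<Sum>k<Suc m. C k w * ?z ^ k))
        \<le> B * (norm ?z / \<sigma>) ^ Suc m / (1 - norm ?z / \<sigma>)"
      unfolding C_def by (rule Taylor_remainder_bound(2)[OF holz[OF w] \<sigma> B[OF _ w]]) (use x[of n] in auto)
    also have "norm ?z = x n" using x[of n] by simp
    also have "B * (x n / \<sigma>) ^ Suc m / (1 - x n / \<sigma>) = B * (x n / \<sigma>) ^ m * ((x n / \<sigma>) / (1 - x n / \<sigma>))"
      by simp
    also have "(x n / \<sigma>) / (1 - x n / \<sigma>) = 1 / (real n + 1)"
      unfolding x(3) by (simp add: divide_simps)
    finally have *: "norm (P ?z w - (\<Sum>k<Suc m. C k w * ?z ^ k)) \<le> B * (x n / \<sigma>) ^ m * (1 / (real n + 1))" .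
    have "F n w - C m w = (P ?z w - (\<Sum>k<Suc m. C k w * ?z ^ k)) / ?z ^ m"
      using x[of n] by (simp add: F_def field_simps)
    then have "norm (F n w - C m w) = norm (P ?z w - (\<Sum>k<Suc m. C k w * ?z ^ k)) / x n ^ m"
      using x[of n] by (simp add: norm_divide norm_power)
    also have "\<dots> \<le> (B * (x n / \<sigma>) ^ m * (1 / (real n + 1))) / x n ^ m"
      by (intro divide_right_mono *) (use x[of n] in auto)
    also have "\<dots> = B / \<sigma> ^ m / (real n + 1)"
      using x(1)[of n] \<sigma> by (simp add: power_divide)
    finally show ?thesis .
  qed
  have lim: "(\<lambda>n. B / \<sigma> ^ m / (real n + 1)) \<longlonglongrightarrow> 0" by real_asymp
  have ul: "uniform_limit (ball 0 \<rho>) F (C m) sequentially"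
  proof (rule uniform_limitI)
    fix e :: real assume "e > 0"
    from order_tendstoD(2)[OF lim this]
    show "\<forall>\<^sub>F n in sequentially. \<forall>w\<in>ball 0 \<rho>. dist (F n w) (C m w) < e"
      by eventually_elim (use bound in \<open>auto simp only: dist_norm intro: le_less_trans\<close>)
  qed
  have "C m holomorphic_on ball 0 \<rho>"
  proof (rule holomorphic_uniform_sequence[OF _ F])
    fix w :: complex assume "w \<in> ball 0 \<rho>"
    then obtain d where "d > 0" "cball w d \<subseteq> ball 0 \<rho>" by (meson open_ball open_contains_cball)
    then show "\<exists>d>0. cball w d \<subseteq> ball 0 \<rho> \<and> uniform_limit (cball w d) F (C m) sequentially"
      using uniform_limit_on_subset[OF ul] by blast
  qed simp
  then show ?case by (simp add: C_def)
qed

text \<open>Expanding in \<open>z\<close> and then each coefficient \<open>C m\<close> in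
  \<open>w\<close> gives coefficients bounded by \<open>B / \<sigma> ^ (m + n)\<close>. A product of
  two geometric series majorizes the double series, and absolute summability equates the unordered
  sum with the iterated one.\<close>

lemma double_power_series:
  fixes P :: "complex \<Rightarrow> complex \<Rightarrow> complex"
  assumes \<sigma>: "0 < \<sigma>" "\<sigma> < \<rho>"
    and holz: "\<And>w. w \<in> ball 0 \<rho> \<Longrightarrow> (\<lambda>z. P z w) holomorphic_on ball 0 \<rho>"
    and holw: "\<And>z. z \<in> ball 0 \<rho> \<Longrightarrow> P z holomorphic_on ball 0 \<rho>"
    and B: "\<And>z w. z \<in> ball 0 \<rho> \<Longrightarrow> w \<in> ball 0 \<rho> \<Longrightarrow> norm (P z w) \<le> B"
  obtains c :: "nat \<Rightarrow> nat \<Rightarrow> complex"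
  where "\<And>z w. norm z < \<sigma> \<Longrightarrow> norm w < \<sigma> \<Longrightarrow>
      (\<lambda>(m, n). norm (c m n * z ^ m * w ^ n)) summable_on UNIV \<and>
      ((\<lambda>(m, n). c m n * z ^ m * w ^ n) has_sum P z w) UNIV"
proof -
  define C where "C = (\<lambda>m w. (deriv ^^ m) (\<lambda>z. P z w) 0 / fact m)"
  define c where "c = (\<lambda>m n. (deriv ^^ n) (C m) 0 / fact n)"
  have \<rho>: "\<rho> > 0" using \<sigma> by simp
  have C: "C m holomorphic_on ball 0 \<rho>" for m
    unfolding C_def by (rule holomorphic_Taylor_coeff[OF \<rho> holz holw B])
  have Cb: "norm (C m w) \<le> B / \<sigma> ^ m" if "w \<in> ball 0 \<rho>" for m w
    unfolding C_def by (rule Taylor_coeff_bound[OF holz[OF that] \<sigma> B[OF _ that]])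
  have cb: "norm (c m n) \<le> B / \<sigma> ^ m / \<sigma> ^ n" for m n
    unfolding c_def by (rule Taylor_coeff_bound[OF C \<sigma> Cb])
  have "B \<ge> 0" using B[of 0 0] \<rho> by (auto intro: order_trans[OF norm_ge_zero])
  show ?thesis
  proof (rule that[of c], rule conjI)
    fix z w :: complex assume z: "norm z < \<sigma>" and w: "norm w < \<sigma>"
    define a b where "a = norm z / \<sigma>" and "b = norm w / \<sigma>"
    have ab: "0 \<le> a" "a < 1" "0 \<le> b" "b < 1" using z w \<sigma> by (auto simp: a_def b_def)
    have geo: "((\<lambda>n. k * x ^ n) has_sum k * (1 / (1 - x))) UNIV" if "0 \<le> k" "0 \<le> x" "x < 1" for k x :: real
    proof -
      have s: "(\<lambda>n. k * x ^ n) sums (k * (1 / (1 - x)))"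
        by (intro sums_mult geometric_sums) (use that in auto)
      then show ?thesis
        by (intro norm_summable_imp_has_sum) (use that in \<open>auto simp: sums_iff\<close>)
    qed
    have "(\<lambda>(m, n). B * a ^ m * b ^ n) summable_on (SIGMA m:UNIV. UNIV)"
    proof (rule summable_on_SigmaI)
      show "((\<lambda>n. case (m, n) of (m, n) \<Rightarrow> B * a ^ m * b ^ n) has_sum (B * a ^ m) * (1 / (1 - b))) UNIV" for m
        using geo[of "B * a ^ m" b] ab \<open>B \<ge> 0\<close> by simp
      show "(\<lambda>m. (B * a ^ m) * (1 / (1 - b))) summable_on UNIV"
        using geo[of B a] ab \<open>B \<ge> 0\<close> by (intro summable_on_cmult_left) (auto simp: summable_on_def)
    qed (use ab \<open>B \<ge> 0\<close> in auto)
    then have dom: "(\<lambda>(m, n). B * a ^ m * b ^ n) summable_on UNIV" by simp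
    have le: "norm (c m n * z ^ m * w ^ n) \<le> B * a ^ m * b ^ n" for m n
    proof -
      have "norm (c m n * z ^ m * w ^ n) = norm (c m n) * (norm z ^ m * norm w ^ n)"
        by (simp add: norm_mult norm_power)
      also have "\<dots> \<le> B / \<sigma> ^ m / \<sigma> ^ n * (norm z ^ m * norm w ^ n)"
        by (intro mult_right_mono cb) auto
      finally show ?thesis by (simp add: a_def b_def power_divide)
    qed
    show abs: "(\<lambda>(m, n). norm (c m n * z ^ m * w ^ n)) summable_on UNIV"
      by (rule summable_on_comparison_test[OF dom]) (use le in auto)
    then have "(\<lambda>p. norm ((\<lambda>(m, n). c m n * z ^ m * w ^ n) p)) summable_on UNIV"
      by (simp only: case_prod_unfold)
    then have "(\<lambda>(m, n). c m n * z ^ m * w ^ n) summable_on UNIV"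
      by (rule abs_summable_summable)
    then obtain S where S: "((\<lambda>(m, n). c m n * z ^ m * w ^ n) has_sum S) UNIV"
      by (auto simp: summable_on_def)
    have ser: "((\<lambda>n. (deriv ^^ n) f 0 / fact n * x ^ n) has_sum f x) UNIV"
      if f: "f holomorphic_on ball 0 \<rho>" and x: "norm x < \<sigma>"
        and fb: "\<And>z. z \<in> ball 0 \<rho> \<Longrightarrow> norm (f z) \<le> D" for f x D
    proof (rule norm_summable_imp_has_sum)
      have "(\<lambda>k. (deriv ^^ k) f 0 / fact k * (x - 0) ^ k) sums f x"
        by (rule holomorphic_power_series[OF f]) (use x \<sigma> in auto)
      then show "(\<lambda>n. (deriv ^^ n) f 0 / fact n * x ^ n) sums f x" by simp
      show "summable (\<lambda>n. norm ((deriv ^^ n) f 0 / fact n * x ^ n))"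
      proof (rule summable_comparison_test', rule summable_mult)
        show "summable (\<lambda>n. (norm x / \<sigma>) ^ n)" using x \<sigma> by (intro summable_geometric) auto
        show "norm (norm ((deriv ^^ n) f 0 / fact n * x ^ n)) \<le> D * (norm x / \<sigma>) ^ n" for n
        proof -
          have "norm ((deriv ^^ n) f 0 / fact n * x ^ n) = norm ((deriv ^^ n) f 0 / fact n) * norm x ^ n"
            by (simp only: norm_mult norm_power)
          also have "\<dots> \<le> D / \<sigma> ^ n * norm x ^ n"
            by (intro mult_right_mono Taylor_coeff_bound[OF f \<sigma> fb]) auto
          finally show ?thesis by (simp add: power_divide)
        qed
      qed
    qed
    have inner: "((\<lambda>n. case (m, n) of (m, n) \<Rightarrow> c m n * z ^ m * w ^ n) has_sum C m w * z ^ m) UNIV" for m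
    proof -
      have "((\<lambda>n. c m n * w ^ n) has_sum C m w) UNIV"
        unfolding c_def by (rule ser[OF C w Cb])
      from has_sum_cmult_left[OF this, of "z ^ m"] show ?thesis by (simp add: mult_ac)
    qed
    have "w \<in> ball 0 \<rho>" using w \<sigma> by auto
    then have outer: "((\<lambda>m. C m w * z ^ m) has_sum P z w) UNIV"
      unfolding C_def using ser[of "\<lambda>z. P z w" z B] holz B z by simp
    \<comment> \<open>Fubini for summable families: summing over \<open>n\<close> first yields the
      expansion of \<open>P\<close> in \<open>z\<close>, which identifies \<open>S\<close>.\<close>
    have "((\<lambda>m. C m w * z ^ m) has_sum S) UNIV"
      using has_sum_SigmaD[where f = "\<lambda>(m, n). c m n * z ^ m * w ^ n" and A = UNIV and B = "\<lambda>_. UNIV"] S inner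
      by simp
    with outer have "S = P z w" by (metis has_sum_unique)
    with S show "((\<lambda>(m, n). c m n * z ^ m * w ^ n) has_sum P z w) UNIV" by simp
  qed
qed

subsection \<open>R-transforms near the origin\<close>

lemma holomorphic_on_lebesgue_integral_bounded:
  fixes f :: "'a \<Rightarrow> complex \<Rightarrow> complex"
  assumes "finite_measure M" and S: "open S" and "AE x in M. x \<in> K"
    and "\<And>z. z \<in> S \<Longrightarrow> (\<lambda>x. f x z) \<in> borel_measurable M"
    and "\<And>x. x \<in> K \<Longrightarrow> f x holomorphic_on S"
    and bdd: "\<And>z x. z \<in> S \<Longrightarrow> x \<in> K \<Longrightarrow> norm (f x z) \<le> B"
  shows "(\<lambda>z. LINT x|M. f x z) holomorphic_on S"
proof (rule holomorphic_on_lebesgue_integral[where K = K])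
  fix z assume "z \<in> S"
  then obtain d where "d > 0" "ball z d \<subseteq> S" using S open_contains_ball by blast
  then show "\<exists>d>0. \<exists>B. ball z d \<subseteq> S \<and> (\<forall>x\<in>K. \<forall>w\<in>ball z d. norm (f x w) \<le> B)"
    using bdd by blast
qed (use assms in auto)

section \<open>Symmetric Stolz angles near 0\<close>

lemma mem_stolz_sym_iff:
  "z \<in> stolz_sym \<alpha> \<beta> \<longleftrightarrow> Im z \<noteq> 0 \<and> \<bar>Re z\<bar> < \<alpha> * \<bar>Im z\<bar> \<and> \<bar>Im z\<bar> < \<beta>"
proof -
  have "z \<in> cnj ` stolz \<alpha> \<beta> \<longleftrightarrow> cnj z \<in> stolz \<alpha> \<beta>"
    by (metis complex_cnj_cnj image_iff)
  then show ?thesis by (auto simp: stolz_sym_def stolz_def)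
qed

lemma stolz_sym_mono: "\<alpha> \<le> \<alpha>' \<Longrightarrow> \<beta> \<le> \<beta>' \<Longrightarrow> stolz_sym \<alpha> \<beta> \<subseteq> stolz_sym \<alpha>' \<beta>'"
proof
  fix z assume le: "\<alpha> \<le> \<alpha>'" "\<beta> \<le> \<beta>'" and z: "z \<in> stolz_sym \<alpha> \<beta>"
  have "\<alpha> * \<bar>Im z\<bar> \<le> \<alpha>' * \<bar>Im z\<bar>" using le by (intro mult_right_mono) auto
  with z le show "z \<in> stolz_sym \<alpha>' \<beta>'" unfolding mem_stolz_sym_iff by linarith
qed

lemma norm_stolz_sym_less:
  assumes "z \<in> stolz_sym \<alpha> \<beta>" "\<alpha> > 0"
  shows "norm z < (1 + \<alpha>) * \<beta>"
proof -
  have "\<bar>Re z\<bar> < \<alpha> * \<bar>Im z\<bar>" "\<bar>Im z\<bar> < \<beta>" using assms by (auto simp: mem_stolz_sym_iff)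
  moreover have "\<alpha> * \<bar>Im z\<bar> \<le> \<alpha> * \<beta>" using assms calculation by (intro mult_left_mono) auto
  ultimately show ?thesis using cmod_le[of z] by (simp add: algebra_simps)
qed

lemma stolz_sym_subset_ball:
  assumes \<alpha>: "\<alpha> > 0" and "\<beta> > 0" "d > 0"
  obtains \<gamma> where "0 < \<gamma>" "\<gamma> \<le> \<beta>" "stolz_sym \<alpha> \<gamma> \<subseteq> ball 0 d"
proof
  define \<gamma> where "\<gamma> = min \<beta> (d / (1 + \<alpha>))"
  show "0 < \<gamma>" "\<gamma> \<le> \<beta>" using assms by (auto simp: \<gamma>_def)
  have "(1 + \<alpha>) * \<gamma> \<le> (1 + \<alpha>) * (d / (1 + \<alpha>))"
    using \<alpha> by (intro mult_left_mono) (auto simp: \<gamma>_def)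
  then have "(1 + \<alpha>) * \<gamma> \<le> d" using \<alpha> by simp
  then show "stolz_sym \<alpha> \<gamma> \<subseteq> ball 0 d"
    using less_le_trans[OF norm_stolz_sym_less[OF _ \<alpha>]] by auto
qed

lemma eventually_stolz_symD:
  assumes "eventually Q (at 0 within stolz_sym \<alpha> \<beta>)" "\<alpha> > 0" "\<beta> > 0"
  obtains \<gamma> where "0 < \<gamma>" "\<gamma> \<le> \<beta>" "\<And>z. z \<in> stolz_sym \<alpha> \<gamma> \<Longrightarrow> Q z"
proof -
  from assms(1) obtain d where d: "d > 0" "\<And>z. z \<in> stolz_sym \<alpha> \<beta> \<Longrightarrow> z \<noteq> 0 \<Longrightarrow> norm z < d \<Longrightarrow> Q z"
    by (auto simp: eventually_at)
  obtain \<gamma> where \<gamma>: "0 < \<gamma>" "\<gamma> \<le> \<beta>" and sub: "stolz_sym \<alpha> \<gamma> \<subseteq> ball 0 d"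
    using stolz_sym_subset_ball[OF assms(2,3) d(1)] .
  show ?thesis
  proof
    fix z assume z: "z \<in> stolz_sym \<alpha> \<gamma>"
    then have "z \<in> stolz_sym \<alpha> \<beta>" using stolz_sym_mono[of \<alpha> \<alpha> \<gamma> \<beta>] \<gamma> by auto
    moreover have "z \<noteq> 0" using z by (auto simp: mem_stolz_sym_iff)
    ultimately show "Q z" using z sub by (intro d(2)) auto
  qed fact+
qed

text \<open>With \<open>\<phi> u = E (1 / (1 - u s))\<close> and \<open>g u = u \<phi> u = G (1 / u)\<close>, the local inverse \<open>f\<close> of \<open>g\<close>
  satisfies \<open>f z = 1 / (1 / z + R z)\<close>; since \<open>\<phi> u - 1 = u \<kappa> u\<close> and \<open>z = f z * \<phi> (f z)\<close>,
  this gives \<open>R = (\<kappa> \<circ> f) / (\<phi> \<circ> f)\<close>, which is holomorphic at 0.\<close>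

lemma analytic_R_transform:
  assumes m: "real_distribution m" and supp: "AE x in m. \<bar>x\<bar> \<le> M" and M: "M > 0"
  obtains \<rho> r where "\<rho> > 0" "r holomorphic_on ball 0 \<rho>"
    "\<And>z. z \<in> ball 0 \<rho> \<Longrightarrow> r (cnj z) = cnj (r z)"
    "\<And>\<alpha> \<beta> R. R_transform_on m \<alpha> \<beta> R \<Longrightarrow> \<alpha> > 0 \<Longrightarrow> \<beta> > 0 \<Longrightarrow>
        \<exists>\<gamma>>0. \<gamma> \<le> \<beta> \<and> (\<forall>z\<in>stolz_sym \<alpha> \<gamma>. R z = r z)"
proof -
  interpret real_distribution m by fact
  define \<phi> where "\<phi> = (\<lambda>u::complex. LINT s|m. 1 / (1 - u * of_real s))"
  \<comment> \<open>\<open>\<kappa> u\<close> is the divided difference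
    \<open>(\<phi> u - 1) / u\<close>, written as an integral so that it is holomorphic at
    \<open>u = 0\<close> as well.\<close>
  define \<kappa> where "\<kappa> = (\<lambda>u::complex. LINT s|m. of_real s / (1 - u * of_real s))"
  define S where "S = ball (0::complex) (1 / (2 * M))"
  define K where "K = {s::real. \<bar>s\<bar> \<le> M}"
  have S: "open S" "0 \<in> S" using M by (auto simp: S_def)
  have K: "AE s in m. s \<in> K" using supp by (simp add: K_def)
  have half: "norm (1 - u * of_real s) \<ge> 1 / 2" if "u \<in> S" "s \<in> K" for u s
  proof -
    have "norm u * \<bar>s\<bar> \<le> 1 / (2 * M) * M"
      by (intro mult_mono) (use that M in \<open>auto simp: S_def K_def\<close>)
    then have "norm (u * of_real s) \<le> 1 / 2" using M by (simp add: norm_mult)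
    then show ?thesis using norm_triangle_ineq2[of 1 "u * of_real s"] by simp
  qed
  have nz: "1 - u * of_real s \<noteq> 0" if "u \<in> S" "s \<in> K" for u s using half[OF that] by auto
  have b\<phi>: "norm (1 / (1 - u * of_real s)) \<le> 2" if "u \<in> S" "s \<in> K" for u s
    using half[OF that] by (simp add: norm_divide divide_le_eq)
  have b\<kappa>: "norm (of_real s / (1 - u * of_real s)) \<le> M * 2" if "u \<in> S" "s \<in> K" for u s
    using mult_mono[OF _ b\<phi>[OF that], of "\<bar>s\<bar>" M] that M by (simp add: norm_divide K_def)
  have h\<phi>: "\<phi> holomorphic_on S" unfolding \<phi>_def
    by (rule holomorphic_on_lebesgue_integral_bounded[where K = K and B = 2])
       (use S K nz b\<phi> in \<open>auto intro!: holomorphic_intros simp: finite_measure_axioms\<close>)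
  have h\<kappa>: "\<kappa> holomorphic_on S" unfolding \<kappa>_def
    by (rule holomorphic_on_lebesgue_integral_bounded[where K = K and B = "M * 2"])
       (use S K nz b\<kappa> in \<open>auto intro!: holomorphic_intros simp: finite_measure_axioms\<close>)
  have \<phi>\<kappa>: "\<phi> u - 1 = u * \<kappa> u" if u: "u \<in> S" for u
  proof -
    have int: "integrable m (\<lambda>s. 1 / (1 - u * of_real s))"
      by (rule integrable_const_bound[where B = 2]) (use K b\<phi>[OF u] in \<open>auto elim: eventually_mono\<close>)
    have "\<phi> u - 1 = (LINT s|m. 1 / (1 - u * of_real s) - 1)"
      unfolding \<phi>_def using int prob_space by simp
    also have "\<dots> = (LINT s|m. u * (of_real s / (1 - u * of_real s)))"
    proof (rule integral_cong_AE)
      show "AE s in m. 1 / (1 - u * of_real s) - 1 = u * (of_real s / (1 - u * of_real s))"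
        using K by eventually_elim (use nz[OF u] in \<open>simp add: divide_simps\<close>)
    qed auto
    finally show ?thesis by (simp add: \<kappa>_def del: times_divide_eq_right)
  qed
  have \<phi>0: "\<phi> 0 = 1" using \<phi>\<kappa>[of 0] S by simp
  have cnj_\<phi>: "\<phi> (cnj u) = cnj (\<phi> u)" for u
    unfolding \<phi>_def by (subst Bochner_Integration.integral_cnj[symmetric]) simp
  have cnj_\<kappa>: "\<kappa> (cnj u) = cnj (\<kappa> u)" for u
    unfolding \<kappa>_def by (subst Bochner_Integration.integral_cnj[symmetric]) simp
  define g where "g = (\<lambda>u. u * \<phi> u)"
  have hg: "g holomorphic_on S" unfolding g_def by (intro holomorphic_intros h\<phi>)
  have "(\<phi> has_field_derivative deriv \<phi> 0) (at 0)" using h\<phi> S holomorphic_derivI by blast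
  then have "(g has_field_derivative 1) (at 0)"
    unfolding g_def by (auto intro!: derivative_eq_intros simp: \<phi>0)
  then have "deriv g 0 \<noteq> 0" by (simp add: DERIV_imp_deriv)
  from has_complex_derivative_locally_injective[OF hg S(2) S(1) this]
  obtain e where e: "e > 0" "ball 0 e \<subseteq> S" "inj_on g (ball 0 e)" .
  have hge: "g holomorphic_on ball 0 e" using hg e(2) holomorphic_on_subset by blast
  obtain f where f: "f holomorphic_on g ` ball 0 e" "\<And>u. u \<in> ball 0 e \<Longrightarrow> f (g u) = u"
    using holomorphic_has_inverse[OF hge open_ball e(3)] by metis
  have "open (g ` ball 0 e)" by (rule open_mapping_thm3[OF hge open_ball e(3)])
  moreover have "0 \<in> g ` ball 0 e" using e(1) by (intro image_eqI[of _ _ 0]) (auto simp: g_def)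
  ultimately obtain \<rho> where \<rho>: "\<rho> > 0" "ball 0 \<rho> \<subseteq> g ` ball 0 e"
    by (meson openE)
  have fz: "f z \<in> ball 0 e" "g (f z) = z" if "z \<in> ball 0 \<rho>" for z
    using that \<rho>(2) f(2) by force+
  \<comment> \<open>A zero of \<open>\<phi>\<close> at \<open>u \<noteq> 0\<close> would give
    \<open>g u = 0 = g 0\<close> and contradict injectivity.\<close>
  have \<phi>nz: "\<phi> u \<noteq> 0" if u: "u \<in> ball 0 e" for u
  proof (cases "u = 0")
    case False
    then have "g u \<noteq> g 0" using e(1,3) u by (auto dest: inj_onD)
    then show ?thesis by (auto simp: g_def)
  qed (simp add: \<phi>0)
  define r where "r = (\<lambda>z. \<kappa> (f z) / \<phi> (f z))"
  show ?thesis
  proof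
    show "\<rho> > 0" by fact
    have hf: "f holomorphic_on ball 0 \<rho>" using f(1) \<rho>(2) holomorphic_on_subset by blast
    have fS: "f ` ball 0 \<rho> \<subseteq> S" using fz(1) e(2) by blast
    have "(\<kappa> \<circ> f) holomorphic_on ball 0 \<rho>" "(\<phi> \<circ> f) holomorphic_on ball 0 \<rho>"
      using holomorphic_on_compose_gen[OF hf h\<kappa>] holomorphic_on_compose_gen[OF hf h\<phi>] fS by auto
    then show "r holomorphic_on ball 0 \<rho>"
      unfolding r_def o_def using \<phi>nz fz(1) by (intro holomorphic_intros) auto
    show "r (cnj z) = cnj (r z)" if z: "z \<in> ball 0 \<rho>" for z
    proof -
      have "g (cnj (f z)) = cnj z"
        using fz(2)[OF z] by (metis cnj_\<phi> complex_cnj_mult g_def)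
      moreover have "cnj (f z) \<in> ball 0 e" using fz(1)[OF z] by simp
      ultimately have "f (cnj z) = cnj (f z)" using f(2) by metis
      then show ?thesis by (simp add: r_def cnj_\<phi> cnj_\<kappa>)
    qed
    fix \<alpha> \<beta> R assume R: "R_transform_on m \<alpha> \<beta> R" and \<alpha>: "\<alpha> > 0" and \<beta>: "\<beta> > 0"
    let ?F = "at 0 within stolz_sym \<alpha> \<beta>"
    have lim: "((\<lambda>z. z * R z) \<longlongrightarrow> 0) ?F" using R by (simp add: R_transform_on_def)
    \<comment> \<open>This quotient is the reciprocal of \<open>1 / z + R z\<close>. Its smallness
      puts it in the ball where \<open>f\<close> inverts \<open>g\<close>, so the given
      \<open>R\<close> belongs to the branch that defines \<open>r\<close>.\<close>
    have "((\<lambda>z. z / (1 + z * R z)) \<longlongrightarrow> 0 / (1 + 0)) ?F"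
      by (intro tendsto_intros lim) auto
    then have "eventually (\<lambda>z. norm (z / (1 + z * R z)) < e) ?F"
      using e(1) order_tendstoD(2)[OF tendsto_norm, of "\<lambda>z. z / (1 + z * R z)" 0] by simp
    then obtain \<gamma> where \<gamma>: "0 < \<gamma>" "\<gamma> \<le> \<beta>"
      and small: "\<And>z. z \<in> stolz_sym \<alpha> \<gamma> \<Longrightarrow> norm (z / (1 + z * R z)) < e"
      using eventually_stolz_symD[OF _ \<alpha> \<beta>] by blast
    have "R z = r z" if z: "z \<in> stolz_sym \<alpha> \<gamma>" for z
    proof -
      define \<zeta> where "\<zeta> = 1 / z + R z"
      have z': "z \<in> stolz_sym \<alpha> \<beta>" using z \<gamma>(2) stolz_sym_mono by blast
      then have "\<zeta> \<notin> \<real>" and G: "cauchy1 m \<zeta> = z" using R by (auto simp: R_transform_on_def \<zeta>_def)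
      then have \<zeta>0: "\<zeta> \<noteq> 0" by auto
      have z0: "z \<noteq> 0" using z by (auto simp: mem_stolz_sym_iff)
      have z\<zeta>: "z * \<zeta> = 1 + z * R z" using z0 by (simp add: \<zeta>_def field_simps)
      define u where "u = 1 / \<zeta>"
      have "u = z / (1 + z * R z)" unfolding u_def z\<zeta>[symmetric] using z0 by simp
      then have u: "u \<in> ball 0 e" using small[OF z] by simp
      have "1 / (\<zeta> - of_real s) = u * (1 / (1 - u * of_real s))" for s
        using \<zeta>0 by (simp add: u_def field_simps)
      then have "cauchy1 m \<zeta> = g u" by (simp only: g_def \<phi>_def cauchy1_def integral_mult_right_zero)
      then have "g u = z" using G by simp
      then have "f z = u" using f(2)[OF u] by simp
      have 1: "\<phi> u = z * \<zeta>" using \<open>g u = z\<close> \<zeta>0 by (simp add: g_def u_def field_simps)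
      have "u * \<kappa> u = z * R z" using \<phi>\<kappa>[of u] u e(2) 1 z\<zeta> by auto
      then have "\<kappa> u = z * \<zeta> * R z" using \<zeta>0 by (simp add: u_def field_simps)
      then show ?thesis using z0 \<zeta>0 by (simp add: r_def \<open>f z = u\<close> 1)
    qed
    with \<gamma> show "\<exists>\<gamma>>0. \<gamma> \<le> \<beta> \<and> (\<forall>z\<in>stolz_sym \<alpha> \<gamma>. R z = r z)" by blast
  qed
qed

subsection \<open>Supports from R-transforms\<close>

lemma open_stolz: "open (stolz \<alpha> \<beta>)"
  unfolding stolz_def by (intro open_Collect_conj open_Collect_less continuous_intros)

lemma stolz_nonempty: "\<alpha> > 0 \<Longrightarrow> \<beta> > 0 \<Longrightarrow> stolz \<alpha> \<beta> \<noteq> {}"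
proof -
  assume "\<alpha> > 0" "\<beta> > 0"
  then have "- (\<i> * of_real (\<beta> / 2)) \<in> stolz \<alpha> \<beta>" by (simp add: stolz_def)
  then show ?thesis by blast
qed

lemma R_transform_on_mono:
  assumes "R_transform_on m \<alpha> \<beta> R" "\<alpha>' \<le> \<alpha>" "\<beta>' \<le> \<beta>"
  shows "R_transform_on m \<alpha>' \<beta>' R"
  using assms stolz_sym_mono[OF assms(2,3)] unfolding R_transform_on_def
  by (meson holomorphic_on_subset subsetD tendsto_within_subset)

text \<open>If the R-transform continues holomorphically to the origin, the law has no mass near a large real \<open>x\<close>:
  the map \<open>K z = 1 / z + t * r z\<close> takes the value \<open>x + i y\<close> at a point \<open>z = G (x + i y)\<close> near 0,
  and as \<open>r\<close> is real on the real axis, \<open>Im (K z)\<close> is comparable to \<open>- Im z / |z|^2\<close>.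
  Hence \<open>Im (G (x + i y))\<close> tends to 0 with \<open>y\<close>. The bound is uniform in \<open>t\<close>.\<close>

lemma support_bound_of_R_transform:
  assumes \<rho>: "\<rho> > 0" and hol: "r holomorphic_on ball 0 \<rho>"
    and sym: "\<And>z. z \<in> ball 0 \<rho> \<Longrightarrow> r (cnj z) = cnj (r z)"
  obtains M :: real where "M > 0"
    "\<And>m t \<alpha> \<beta> R. real_distribution m \<Longrightarrow> 0 \<le> t \<Longrightarrow> t \<le> 1 \<Longrightarrow> \<alpha> > 0 \<Longrightarrow> \<beta> > 0 \<Longrightarrow>
      R_transform_on m \<alpha> \<beta> R \<Longrightarrow> (\<And>z. z \<in> stolz_sym \<alpha> \<beta> \<Longrightarrow> R z = of_real t * r z) \<Longrightarrow>
      AE x in m. \<bar>x\<bar> \<le> M"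
proof -
  have "continuous_on (cball 0 (\<rho>/2)) r"
    using hol \<rho> by (intro holomorphic_on_imp_continuous_on[OF holomorphic_on_subset[OF hol]]) auto
  then have "bounded (r ` cball 0 (\<rho>/2))"
    by (intro compact_imp_bounded compact_continuous_image) auto
  then obtain B where B: "B > 0" "\<And>z. z \<in> cball 0 (\<rho>/2) \<Longrightarrow> norm (r z) \<le> B"
    unfolding bounded_pos by auto
  \<comment> \<open>The Lipschitz constant \<open>4 * B / (\<rho>/2)\<close> of \<open>r\<close>.
    Applied to \<open>z\<close> and \<open>cnj z\<close>, where the differences are
    \<open>2 i Im (r z)\<close> and \<open>2 i Im z\<close>, it bounds \<open>Im (r z)\<close> by
    \<open>L\<close> times \<open>Im z\<close>.\<close>
  define L where "L = 8 * B / \<rho>"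
  have L: "L > 0" using B \<rho> by (simp add: L_def)
  have Im_r: "\<bar>Im (r z)\<bar> \<le> L * \<bar>Im z\<bar>" if z: "z \<in> ball 0 (\<rho>/4)" for z
  proof -
    have "norm (r z - r (cnj z)) \<le> 4 * B / (\<rho>/2) * norm (z - cnj z)"
      by (rule norm_diff_le_of_holomorphic_bounded[of _ 0, OF holomorphic_on_subset[OF hol]])
         (use \<rho> B z in auto)
    moreover have "r (cnj z) = cnj (r z)" using z \<rho> by (intro sym) auto
    ultimately show ?thesis
      by (simp add: complex_diff_cnj norm_mult L_def)
  qed
  \<comment> \<open>\<open>\<rho>/8\<close> stays within the discs where \<open>B\<close> and
    \<open>L\<close> are valid; \<open>1/B\<close> gives \<open>\<sigma> * B \<le> 1\<close> for the
    fixed-point map; \<open>1/(2*L)\<close> and 1 give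
    \<open>L * \<sigma>\<^sup>2 \<le> 1/2\<close>, so that \<open>t * r\<close> changes the
    imaginary part of \<open>1 / z\<close> by at most half of it.\<close>
  define \<sigma> where "\<sigma> = Min {\<rho>/8, 1/B, 1/(2*L), 1}"
  have \<sigma>: "\<sigma> > 0" "\<sigma> \<le> \<rho>/8" "\<sigma> \<le> 1/B" "\<sigma> \<le> 1/(2*L)" "\<sigma> \<le> 1"
    using \<rho> B L by (auto simp: \<sigma>_def)
  have \<sigma>B: "\<sigma> * B \<le> 1" using \<sigma>(3) B(1) by (simp add: pos_le_divide_eq)
  have "\<sigma> * L \<le> 1/2" using \<sigma>(4) L by (simp add: pos_le_divide_eq)
  then have \<sigma>L: "\<sigma> * (\<sigma> * L) \<le> 1 * (1/2)" using \<sigma> L by (intro mult_mono) auto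
  show ?thesis
  proof
    \<comment> \<open>Beyond \<open>4 / \<sigma>\<close> the fixed-point map preserves a disc; the
      extra 1 is the strict margin that \<open>AE_bounded_of_cauchy1\<close> asks for.\<close>
    show "4 / \<sigma> + 1 > 0" using \<sigma> by (simp add: add_pos_pos)
    fix m t \<alpha> \<beta> R
    assume m: "real_distribution m" and t: "0 \<le> t" "t \<le> (1::real)" and \<alpha>: "\<alpha> > 0" and \<beta>: "\<beta> > 0"
      and R: "R_transform_on m \<alpha> \<beta> R" and Rr: "\<And>z. z \<in> stolz_sym \<alpha> \<beta> \<Longrightarrow> R z = of_real t * r z"
    define K where "K = (\<lambda>z. 1 / z + of_real t * r z)"
    have Im_K: "\<bar>Im (K z) + Im z / (norm z)\<^sup>2\<bar> \<le> \<bar>Im z\<bar> / (2 * (norm z)\<^sup>2)"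
      if z: "z \<in> ball 0 \<sigma>" "z \<noteq> 0" for z
    proof -
      have "Im (1 / z) = - (Im z / (norm z)\<^sup>2)" by (simp add: Im_divide cmod_power2)
      then have "\<bar>Im (K z) + Im z / (norm z)\<^sup>2\<bar> = t * \<bar>Im (r z)\<bar>"
        using t by (simp add: K_def abs_mult)
      also have "\<dots> \<le> 1 * (L * \<bar>Im z\<bar>)"
        using t z \<sigma> \<rho> by (intro mult_mono Im_r) auto
      also have "\<dots> \<le> \<bar>Im z\<bar> / (2 * (norm z)\<^sup>2)"
      proof -
        have "L * (norm z)\<^sup>2 \<le> L * \<sigma>\<^sup>2"
          using z L by (intro mult_left_mono power_mono) auto
        then have "L * (norm z)\<^sup>2 \<le> 1 / 2" using \<sigma>L by (simp add: power2_eq_square mult_ac)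
        then have "L * (norm z)\<^sup>2 * \<bar>Im z\<bar> \<le> 1 / 2 * \<bar>Im z\<bar>" by (intro mult_right_mono) auto
        then show ?thesis using z(2) by (simp add: field_simps)
      qed
      finally show ?thesis .
    qed
    \<comment> \<open>The half disc is connected and \<open>K\<close> maps it into the upper
      half-plane, where \<open>cauchy1 m\<close> is holomorphic. The inversion formula, known on an
      angle of uncontrolled size, therefore continues to all of \<open>U\<close>.\<close>
    define U where "U = ball 0 \<sigma> \<inter> {z. Im z < 0}"
    have U: "open U" "connected U"
      unfolding U_def by (auto intro!: open_Int convex_connected convex_Int convex_halfspace_Im_lt
          open_halfspace_Im_lt)
    have KU: "Im (K z) > 0" if "z \<in> U" for z
    proof -
      have z: "z \<in> ball 0 \<sigma>" "z \<noteq> 0" "Im z < 0" using that by (auto simp: U_def)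
      have "\<bar>Im z\<bar> / (2 * (norm z)\<^sup>2) < - Im z / (norm z)\<^sup>2"
        using z(2,3) by (simp add: field_simps)
      with Im_K[OF z(1,2)] show ?thesis by (simp add: abs_if split: if_splits)
    qed
    have G: "cauchy1 m holomorphic_on {\<zeta>. Im \<zeta> > 0}"
      unfolding cauchy1_def
    proof (rule holomorphic_on_lebesgue_integral[where K = UNIV])
      interpret real_distribution m by fact
      show "finite_measure m" by (rule finite_measure_axioms)
      show "open {\<zeta>. Im \<zeta> > 0}" by (rule open_halfspace_Im_gt)
      show "AE x in m. x \<in> UNIV" by simp
      show "(\<lambda>x. 1 / (z - of_real x)) \<in> borel_measurable m" for z :: complex by simp
      show "(\<lambda>z. 1 / (z - of_real x)) holomorphic_on {\<zeta>. Im \<zeta> > 0}" for x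
        by (intro holomorphic_intros) auto
      fix z assume z: "z \<in> {\<zeta>. Im \<zeta> > 0}"
      have Imw: "Im w \<ge> Im z / 2" if "w \<in> ball z (Im z / 2)" for w
        using abs_Im_le_cmod[of "z - w"] that by (simp add: dist_norm abs_if split: if_splits)
      have "norm (1 / (w - of_real x)) \<le> 1 / (Im z / 2)" if "w \<in> ball z (Im z / 2)" for w x
      proof -
        have "Im z / 2 \<le> norm (w - of_real x)"
          using Imw[OF that] abs_Im_le_cmod[of "w - of_real x"] by simp
        then have "1 / norm (w - of_real x) \<le> 1 / (Im z / 2)"
          using z by (intro divide_left_mono) (auto simp: less_le_trans intro!: mult_pos_pos)
        then show ?thesis by (simp add: norm_divide)
      qed
      moreover have "ball z (Im z / 2) \<subseteq> {\<zeta>. Im \<zeta> > 0}" using Imw z by force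
      ultimately show "\<exists>d>0. \<exists>B. ball z d \<subseteq> {\<zeta>. Im \<zeta> > 0} \<and>
          (\<forall>x\<in>UNIV. \<forall>w\<in>ball z d. norm (1 / (w - of_real x)) \<le> B)"
        using z by (intro exI[of _ "Im z / 2"] conjI exI[of _ "1 / (Im z / 2)"]) auto
    qed
    have K: "K holomorphic_on U"
      unfolding K_def using \<sigma>(2) \<rho>
      by (intro holomorphic_intros holomorphic_on_subset[OF hol]) (auto simp: U_def)
    obtain \<gamma> where \<gamma>: "0 < \<gamma>" "\<gamma> \<le> \<beta>" and ball: "stolz_sym \<alpha> \<gamma> \<subseteq> ball 0 \<sigma>"
      using stolz_sym_subset_ball[OF \<alpha> \<beta> \<sigma>(1)] .
    have GK: "cauchy1 m (K z) = z" if "z \<in> U" for z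
    proof (rule analytic_continuation_open[where s' = U])
      show "open (stolz \<alpha> \<gamma>)" "stolz \<alpha> \<gamma> \<noteq> {}" using open_stolz stolz_nonempty \<alpha> \<gamma> by auto
      have sub: "stolz \<alpha> \<gamma> \<subseteq> stolz_sym \<alpha> \<gamma>" by (auto simp: stolz_sym_def)
      show "stolz \<alpha> \<gamma> \<subseteq> U" using ball sub by (auto simp: U_def stolz_def)
      show "(\<lambda>z. cauchy1 m (K z)) holomorphic_on U"
        using holomorphic_on_compose_gen[OF K G] KU by (auto simp: o_def)
      show "(\<lambda>z. z) holomorphic_on U" by (rule holomorphic_on_ident)
      show "cauchy1 m (K z) = z" if "z \<in> stolz \<alpha> \<gamma>" for z
      proof -
        have "z \<in> stolz_sym \<alpha> \<beta>" using that sub stolz_sym_mono[of \<alpha> \<alpha> \<gamma> \<beta>] \<gamma> by auto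
        then show ?thesis using R Rr by (auto simp: R_transform_on_def K_def)
      qed
    qed (use U that in auto)
    have bound: "\<bar>Im (cauchy1 m (Complex x y))\<bar> \<le> 2 * \<sigma>\<^sup>2 * y" if x: "\<bar>x\<bar> > 4 / \<sigma>" and y: "y > 0" for x y
    proof -
      define \<zeta> where "\<zeta> = Complex x y"
      have \<zeta>: "norm \<zeta> > 4 / \<sigma>" using x abs_Re_le_cmod[of \<zeta>] by (simp add: \<zeta>_def)
      have \<zeta>0: "\<zeta> \<noteq> 0" using y by (auto simp: \<zeta>_def complex_eq_iff)
      \<comment> \<open>\<open>K z = \<zeta>\<close> in fixed-point form. The numerator has modulus
        at most 2 and \<open>norm \<zeta> > 4 / \<sigma>\<close>, so Brouwer applies on the disc of
        radius \<open>\<sigma>/2\<close>; \<open>GK\<close> will identify the solution with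
        \<open>cauchy1 m \<zeta>\<close>.\<close>
      obtain z where z: "z \<in> cball 0 (\<sigma>/2)" and fp: "(1 + of_real t * z * r z) / \<zeta> = z"
      proof (rule brouwer_ball[of "\<sigma>/2" 0 "\<lambda>z. (1 + of_real t * z * r z) / \<zeta>"])
        show "continuous_on (cball 0 (\<sigma>/2)) (\<lambda>z. (1 + of_real t * z * r z) / \<zeta>)"
          using \<sigma> \<rho> \<zeta>0 by (intro continuous_intros
            holomorphic_on_imp_continuous_on[OF holomorphic_on_subset[OF hol]]) auto
        show "(\<lambda>z. (1 + of_real t * z * r z) / \<zeta>) \<in> cball 0 (\<sigma>/2) \<rightarrow> cball 0 (\<sigma>/2)"
        proof
          fix z :: complex assume z: "z \<in> cball 0 (\<sigma>/2)"
          have "norm (of_real t * z * r z) \<le> 1 * \<sigma> * B"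
            unfolding norm_mult using t z \<sigma> B by (intro mult_mono B) auto
          then have "norm (1 + of_real t * z * r z) \<le> 2"
            using norm_triangle_ineq[of 1 "of_real t * z * r z"] \<sigma>B by simp
          then have "norm ((1 + of_real t * z * r z) / \<zeta>) \<le> 2 / (4 / \<sigma>)"
            unfolding norm_divide using \<zeta> \<sigma> by (intro frac_le) auto
          then show "(1 + of_real t * z * r z) / \<zeta> \<in> cball 0 (\<sigma>/2)" by simp
        qed
      qed (use \<sigma> in auto)
      have z0: "z \<noteq> 0" using fp \<zeta>0 by auto
      have Kz: "K z = \<zeta>" using fp z0 \<zeta>0 by (simp add: K_def field_simps)
      have zb: "z \<in> ball 0 \<sigma>" using z \<sigma> by auto
      have Imz: "\<bar>y + Im z / (norm z)\<^sup>2\<bar> \<le> \<bar>Im z\<bar> / (2 * (norm z)\<^sup>2)"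
        using Im_K[OF zb z0] by (simp add: Kz) (simp add: \<zeta>_def)
      have p: "(norm z)\<^sup>2 > 0" using z0 by simp
      \<comment> \<open>Otherwise \<open>Imz\<close> would force \<open>y \<le> 0\<close>. The sign
        is what places \<open>z\<close> in \<open>U\<close>.\<close>
      have "Im z < 0"
      proof (rule ccontr)
        assume "\<not> Im z < 0"
        then have "\<bar>Im z\<bar> / (2 * (norm z)\<^sup>2) \<le> Im z / (norm z)\<^sup>2" using p by (simp add: field_simps)
        with Imz y show False by (simp add: abs_if split: if_splits)
      qed
      then have "z \<in> U" using zb by (simp add: U_def)
      then have Gz: "cauchy1 m \<zeta> = z" using GK Kz by metis
      have "- Im z / (2 * (norm z)\<^sup>2) \<le> y"
      proof -
        have "- (Im z / (norm z)\<^sup>2) - \<bar>Im z\<bar> / (2 * (norm z)\<^sup>2) \<le> y" using Imz by linarith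
        moreover have "- (Im z / (norm z)\<^sup>2) - \<bar>Im z\<bar> / (2 * (norm z)\<^sup>2) = - Im z / (2 * (norm z)\<^sup>2)"
          using \<open>Im z < 0\<close> p by (simp add: field_simps)
        ultimately show ?thesis by simp
      qed
      then have "- Im z \<le> 2 * (norm z)\<^sup>2 * y" using p by (simp add: field_simps)
      also have "\<dots> \<le> 2 * \<sigma>\<^sup>2 * y"
        using zb y by (intro mult_right_mono mult_left_mono power_mono) auto
      finally show ?thesis using Gz \<open>Im z < 0\<close> by (simp add: \<zeta>_def)
    qed
    show "AE x in m. \<bar>x\<bar> \<le> 4 / \<sigma> + 1"
    proof (rule AE_bounded_of_cauchy1[OF m, of "4 / \<sigma>"])
      fix x :: real assume x: "\<bar>x\<bar> > 4 / \<sigma>"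
      have "((\<lambda>y. 2 * \<sigma>\<^sup>2 * y) \<longlongrightarrow> 2 * \<sigma>\<^sup>2 * 0) (at_right 0)" by (intro tendsto_intros)
      then have l: "((\<lambda>y. 2 * \<sigma>\<^sup>2 * y) \<longlongrightarrow> 0) (at_right 0)" by simp
      show "((\<lambda>y. Im (cauchy1 m (Complex x y))) \<longlongrightarrow> 0) (at_right 0)"
        by (rule Lim_null_comparison[OF _ l])
           (use bound[OF x] in \<open>auto simp: eventually_at_filter\<close>)
    qed simp
  qed
qed

subsection \<open>Marginals of the bi-free R-transform\<close>

text \<open>The marginal transforms, bound existentially in \<open>bifree_R_on\<close>, become
  parameters, so that shrinking the domain keeps the same witnesses.\<close>

definition bifree_R_with ::
    "(real \<times> real) measure \<Rightarrow> real \<Rightarrow> real \<Rightarrow> (complex \<Rightarrow> complex) \<Rightarrow> (complex \<Rightarrow> complex) \<Rightarrow>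
      (complex \<Rightarrow> complex \<Rightarrow> complex) \<Rightarrow> bool" where
  "bifree_R_with \<mu> \<alpha> \<beta> R1 R2 R \<longleftrightarrow>
     R_transform_on (marginal1 \<mu>) \<alpha> \<beta> R1 \<and> R_transform_on (marginal2 \<mu>) \<alpha> \<beta> R2 \<and>
     (\<forall>z\<in>stolz_sym \<alpha> \<beta>. \<forall>w\<in>stolz_sym \<alpha> \<beta>.
        h_bifree \<mu> R1 R2 z w \<noteq> 0 \<and>
        R z w = z * R1 z + w * R2 w + (1 - 1 / h_bifree \<mu> R1 R2 z w))"

lemma bifree_R_on_iff: "bifree_R_on \<mu> \<alpha> \<beta> R \<longleftrightarrow> (\<exists>R1 R2. bifree_R_with \<mu> \<alpha> \<beta> R1 R2 R)"
  by (simp add: bifree_R_on_def bifree_R_with_def)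

lemma bifree_R_with_mono:
  assumes "bifree_R_with \<mu> \<alpha> \<beta> R1 R2 R" "\<alpha>' \<le> \<alpha>" "\<beta>' \<le> \<beta>"
  shows "bifree_R_with \<mu> \<alpha>' \<beta>' R1 R2 R"
  using assms stolz_sym_mono[OF assms(2,3)] R_transform_on_mono[OF _ assms(2,3)]
  unfolding bifree_R_with_def by (meson subsetD)

lemma plane_law_sets: "plane_law \<mu> \<Longrightarrow> sets \<mu> = sets borel"
  by (simp add: plane_law_def)

lemma plane_law_measurable:
  "plane_law \<mu> \<Longrightarrow> f \<in> borel_measurable borel \<Longrightarrow> f \<in> borel_measurable \<mu>"
  by (simp add: plane_law_sets cong: measurable_cong_sets)

lemma fst_snd_borel: "fst \<in> borel_measurable (borel :: (real \<times> real) measure)"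
    "snd \<in> borel_measurable (borel :: (real \<times> real) measure)"
  by (auto intro!: borel_measurable_continuous_onI continuous_intros)

lemma real_distribution_marginals:
  assumes "plane_law \<mu>"
  shows "real_distribution (marginal1 \<mu>)" "real_distribution (marginal2 \<mu>)"
proof -
  interpret prob_space \<mu> using assms by (simp add: plane_law_def)
  show "real_distribution (marginal1 \<mu>)" "real_distribution (marginal2 \<mu>)"
    using plane_law_measurable[OF assms] fst_snd_borel by (auto simp: marginal1_def marginal2_def)
qed

lemma cauchy1_marginals:
  assumes "plane_law \<mu>"
  shows "cauchy1 (marginal1 \<mu>) \<zeta> = (LINT p|\<mu>. 1 / (\<zeta> - of_real (fst p)))"
    and "cauchy1 (marginal2 \<mu>) \<zeta> = (LINT p|\<mu>. 1 / (\<zeta> - of_real (snd p)))"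
proof -
  have m: "fst \<in> borel_measurable \<mu>" "snd \<in> borel_measurable \<mu>"
    using plane_law_measurable[OF assms] fst_snd_borel by auto
  have k: "(\<lambda>x. 1 / (\<zeta> - complex_of_real x)) \<in> borel_measurable borel" by measurable
  show "cauchy1 (marginal1 \<mu>) \<zeta> = (LINT p|\<mu>. 1 / (\<zeta> - of_real (fst p)))"
    and "cauchy1 (marginal2 \<mu>) \<zeta> = (LINT p|\<mu>. 1 / (\<zeta> - of_real (snd p)))"
    unfolding cauchy1_def marginal1_def marginal2_def
    by (rule integral_distr[OF m(1) k], rule integral_distr[OF m(2) k])
qed

text \<open>Since \<open>w n * K n = 1 + e n\<close>, the second factor divided by
  \<open>w n\<close> is \<open>1 / (1 + e n - w n * Y p)\<close>, which tends to 1 pointwise. Along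
  the imaginary axis these factors stay bounded however large \<open>Y p\<close> is, so dominated
  convergence works for unbounded supports. \<open>X\<close> and \<open>Y\<close> are abstract so
  that the coordinates can be exchanged.\<close>

lemma LIMSEQ_product_kernel:
  fixes X Y :: "'a \<Rightarrow> real" and e K :: "nat \<Rightarrow> complex"
  defines "w \<equiv> \<lambda>n. - \<i> / of_nat (Suc n)"
  assumes M: "prob_space M" and X: "X \<in> borel_measurable M" and Y: "Y \<in> borel_measurable M"
    and k: "Im k \<noteq> 0" and z: "z \<noteq> 0" and G: "(LINT p|M. 1 / (k - of_real (X p))) = z"
    and e: "e \<longlonglongrightarrow> 0" and K: "eventually (\<lambda>n. w n * K n = 1 + e n) sequentially"
  shows "(\<lambda>n. (LINT p|M. 1 / ((k - of_real (X p)) * (K n - of_real (Y p)))) / (z * w n)) \<longlonglongrightarrow> 1"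
proof -
  interpret prob_space M by fact
  have "eventually (\<lambda>n. norm (e n) < 1 / 2) sequentially"
    using e by (auto simp: tendsto_iff dest: spec[of _ "1/2"])
  with K have "eventually (\<lambda>n. norm (e n) < 1 / 2 \<and> w n * K n = 1 + e n) sequentially"
    by (rule eventually_conj[THEN eventually_mono]) auto
  then obtain N where N: "norm (e n) < 1 / 2" "w n * K n = 1 + e n" if "n \<ge> N" for n
    by (auto simp: eventually_sequentially)
  have w0: "w n \<noteq> 0" for n by (simp add: w_def del: of_nat_Suc)
  have "(\<lambda>n. 1 / real (Suc n)) \<longlonglongrightarrow> 0" by real_asymp
  then have "(\<lambda>n. - \<i> * of_real (1 / real (Suc n))) \<longlonglongrightarrow> - \<i> * of_real 0" by (intro tendsto_intros)
  then have w: "w \<longlonglongrightarrow> 0" by (simp add: w_def)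
  define q where "q = (\<lambda>n p. 1 / (k - of_real (X p)) * (1 / (1 + e n - w n * of_real (Y p))))"
  have "(\<lambda>n. LINT p|M. q (n + N) p) \<longlonglongrightarrow> (LINT p|M. 1 / (k - of_real (X p)))"
  proof (rule integral_dominated_convergence)
    show "AE p in M. (\<lambda>n. q (n + N) p) \<longlonglongrightarrow> 1 / (k - of_real (X p))"
    proof (rule AE_I2)
      fix p
      have "(\<lambda>n. q n p) \<longlonglongrightarrow> 1 / (k - of_real (X p)) * (1 / (1 + 0 - 0 * of_real (Y p)))"
        unfolding q_def by (intro tendsto_intros e w) auto
      then show "(\<lambda>n. q (n + N) p) \<longlonglongrightarrow> 1 / (k - of_real (X p))"
        by (intro LIMSEQ_ignore_initial_segment) simp
    qed
    show "AE p in M. norm (q (n + N) p) \<le> 1 / \<bar>Im k\<bar> * 2" for n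
    proof (rule AE_I2)
      fix p
      have "norm (k - of_real (X p)) \<ge> \<bar>Im k\<bar>" using abs_Im_le_cmod[of "k - of_real (X p)"] by simp
      then have 1: "norm (1 / (k - of_real (X p))) \<le> 1 / \<bar>Im k\<bar>"
        using k by (simp add: norm_divide frac_le)
      \<comment> \<open>An imaginary \<open>w\<close> gives \<open>1 - w * Y\<close> the real part
        1, hence modulus at least 1; the error \<open>e\<close> costs at most 1/2 of it.\<close>
      have "Re (w (n + N)) = 0" by (simp add: w_def Re_divide)
      then have "1 \<le> norm (1 - w (n + N) * of_real (Y p))"
        using abs_Re_le_cmod[of "1 - w (n + N) * of_real (Y p)"] by simp
      moreover have "norm (e (n + N)) < 1 / 2" using N by simp
      ultimately have "norm (1 + e (n + N) - w (n + N) * of_real (Y p)) \<ge> 1 / 2"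
        using norm_triangle_ineq4[of "1 + e (n + N) - w (n + N) * of_real (Y p)" "e (n + N)"]
        by (simp add: algebra_simps)
      then have 2: "norm (1 / (1 + e (n + N) - w (n + N) * of_real (Y p))) \<le> 2"
        using frac_le[of 1 1 "1/2" "norm (1 + e (n + N) - w (n + N) * of_real (Y p))"]
        by (simp add: norm_divide)
      show "norm (q (n + N) p) \<le> 1 / \<bar>Im k\<bar> * 2"
        unfolding q_def norm_mult using 1 2 by (intro mult_mono) auto
    qed
  qed (use X Y in \<open>auto simp: q_def\<close>)
  then have "(\<lambda>n. LINT p|M. q n p) \<longlonglongrightarrow> z" unfolding G by (rule LIMSEQ_offset)
  then have "(\<lambda>n. (LINT p|M. q n p) / z) \<longlonglongrightarrow> z / z" by (intro tendsto_intros z)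
  then have lim: "(\<lambda>n. (LINT p|M. q n p) / z) \<longlonglongrightarrow> 1" using z by simp
  have eq: "(LINT p|M. 1 / ((k - of_real (X p)) * (K n - of_real (Y p)))) / (z * w n) = (LINT p|M. q n p) / z"
    if "n \<ge> N" for n
  proof -
    have "1 / ((k - of_real (X p)) * (K n - of_real (Y p))) = q n p * w n" for p
    proof -
      have "1 + e n - w n * of_real (Y p) = w n * (K n - of_real (Y p))"
        using N(2)[OF that] by (simp add: algebra_simps)
      then show ?thesis using w0[of n] by (simp add: q_def)
    qed
    then show ?thesis using w0[of n] by simp
  qed
  show ?thesis
    by (rule Lim_transform_eventually[OF lim])
       (use eq in \<open>auto simp only: eventually_sequentially intro!: exI[of _ N]\<close>)
qed

lemma imaginary_sequence_in_stolz:
  assumes "\<alpha> > 0" "\<beta> > 0"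
  shows "filterlim (\<lambda>n. - \<i> / of_nat (Suc n)) (at 0 within stolz_sym \<alpha> \<beta>) sequentially"
    and "eventually (\<lambda>n. - \<i> / of_nat (Suc n) \<in> stolz_sym \<alpha> \<beta>) sequentially"
proof -
  have r: "- \<i> / of_nat (Suc n) = - \<i> * of_real (1 / real (Suc n))" for n by simp
  have l: "(\<lambda>n. 1 / real (Suc n)) \<longlonglongrightarrow> 0" by real_asymp
  then have "(\<lambda>n. - \<i> * of_real (1 / real (Suc n))) \<longlonglongrightarrow> - \<i> * of_real 0" by (intro tendsto_intros)
  then have w: "(\<lambda>n. - \<i> / of_nat (Suc n)) \<longlonglongrightarrow> 0" unfolding r by simp
  have "eventually (\<lambda>n. 1 / real (Suc n) < \<beta>) sequentially" using order_tendstoD(2)[OF l assms(2)] .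
  then show ev: "eventually (\<lambda>n. - \<i> / of_nat (Suc n) \<in> stolz_sym \<alpha> \<beta>) sequentially"
    unfolding r by eventually_elim (use assms in \<open>auto simp: mem_stolz_sym_iff abs_mult simp del: of_real_divide of_nat_Suc\<close>)
  show "filterlim (\<lambda>n. - \<i> / of_nat (Suc n)) (at 0 within stolz_sym \<alpha> \<beta>) sequentially"
    unfolding filterlim_at using w ev by (auto elim: eventually_mono simp del: of_nat_Suc)
qed

text \<open>When one variable tends to 0, \<open>h_bifree\<close> tends to 1 and the mixed term
  vanishes, and so does the summand of that variable. What survives is a marginal transform, which
  is thus determined by the two-variable one.\<close>

lemma bifree_R_marginal_limits:
  assumes \<mu>: "plane_law \<mu>" and R: "bifree_R_with \<mu> \<alpha> \<beta> R1 R2 R" and \<alpha>: "\<alpha> > 0" and \<beta>: "\<beta> > 0"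
    and z: "z \<in> stolz_sym \<alpha> \<beta>"
  shows "(\<lambda>n. R z (- \<i> / of_nat (Suc n))) \<longlonglongrightarrow> z * R1 z"
    and "(\<lambda>n. R (- \<i> / of_nat (Suc n)) z) \<longlonglongrightarrow> z * R2 z"
proof -
  define w where "w = (\<lambda>n. - \<i> / of_nat (Suc n) :: complex)"
  have fl: "filterlim w (at 0 within stolz_sym \<alpha> \<beta>) sequentially"
      "eventually (\<lambda>n. w n \<in> stolz_sym \<alpha> \<beta>) sequentially"
    unfolding w_def by (rule imaginary_sequence_in_stolz[OF \<alpha> \<beta>])+
  have P: "prob_space \<mu>" using \<mu> by (simp add: plane_law_def)
  have ms: "fst \<in> borel_measurable \<mu>" "snd \<in> borel_measurable \<mu>"
    using \<mu> fst_snd_borel plane_law_measurable by blast+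
  have z0: "z \<noteq> 0" using z by (auto simp: mem_stolz_sym_iff)
  have w0: "w n \<noteq> 0" for n by (simp add: w_def del: of_nat_Suc)
  have R1: "R_transform_on (marginal1 \<mu>) \<alpha> \<beta> R1" and R2: "R_transform_on (marginal2 \<mu>) \<alpha> \<beta> R2"
    and eq: "\<And>z w. z \<in> stolz_sym \<alpha> \<beta> \<Longrightarrow> w \<in> stolz_sym \<alpha> \<beta> \<Longrightarrow>
        R z w = z * R1 z + w * R2 w + (1 - 1 / h_bifree \<mu> R1 R2 z w)"
    using R by (auto simp: bifree_R_with_def)
  have l1: "(\<lambda>n. w n * R1 (w n)) \<longlonglongrightarrow> 0" and l2: "(\<lambda>n. w n * R2 (w n)) \<longlonglongrightarrow> 0"
    using R1 R2 filterlim_compose[OF _ fl(1)] unfolding R_transform_on_def by blast+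
  have 1: "Im (1 / z + R1 z) \<noteq> 0" "(LINT p|\<mu>. 1 / (1 / z + R1 z - of_real (fst p))) = z"
   and 2: "Im (1 / z + R2 z) \<noteq> 0" "(LINT p|\<mu>. 1 / (1 / z + R2 z - of_real (snd p))) = z"
    using R1 R2 z cauchy1_marginals[OF \<mu>]
    by (auto simp: R_transform_on_def complex_is_Real_iff)
  have h1: "(\<lambda>n. h_bifree \<mu> R1 R2 z (w n)) \<longlonglongrightarrow> 1"
    unfolding h_bifree_def cauchy2_def case_prod_unfold w_def
    by (rule LIMSEQ_product_kernel[OF P ms(1,2) 1(1) z0 1(2) l2[unfolded w_def]])
       (use w0 in \<open>auto simp: w_def field_simps\<close>)
  have h2: "(\<lambda>n. h_bifree \<mu> R1 R2 (w n) z) \<longlonglongrightarrow> 1"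
  proof -
    have "(\<lambda>n. (LINT p|\<mu>. 1 / ((1 / z + R2 z - of_real (snd p)) * (1 / w n + R1 (w n) - of_real (fst p))))
        / (z * w n)) \<longlonglongrightarrow> 1"
      unfolding w_def
      by (rule LIMSEQ_product_kernel[OF P ms(2,1) 2(1) z0 2(2) l1[unfolded w_def]])
         (use w0 in \<open>auto simp: w_def field_simps\<close>)
    then show ?thesis by (simp add: h_bifree_def cauchy2_def case_prod_unfold mult.commute)
  qed
  have "(\<lambda>n. z * R1 z + w n * R2 (w n) + (1 - 1 / h_bifree \<mu> R1 R2 z (w n))) \<longlonglongrightarrow> z * R1 z + 0 + (1 - 1 / 1)"
    by (intro tendsto_intros h1 l2) auto
  then have "(\<lambda>n. R z (w n)) \<longlonglongrightarrow> z * R1 z + 0 + (1 - 1 / 1)"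
    by (rule Lim_transform_eventually) (use fl(2) in eventually_elim, simp add: eq[OF z])
  then show "(\<lambda>n. R z (- \<i> / of_nat (Suc n))) \<longlonglongrightarrow> z * R1 z" by (simp add: w_def)
  have "(\<lambda>n. w n * R1 (w n) + z * R2 z + (1 - 1 / h_bifree \<mu> R1 R2 (w n) z)) \<longlonglongrightarrow> 0 + z * R2 z + (1 - 1 / 1)"
    by (intro tendsto_intros h2 l1) auto
  then have "(\<lambda>n. R (w n) z) \<longlonglongrightarrow> 0 + z * R2 z + (1 - 1 / 1)"
    by (rule Lim_transform_eventually) (use fl(2) in eventually_elim, simp add: eq[OF _ z])
  then show "(\<lambda>n. R (- \<i> / of_nat (Suc n)) z) \<longlonglongrightarrow> z * R2 z" by (simp add: w_def)
qed

subsection \<open>The rescaled Cauchy transform\<close>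

text \<open>Two uses of the one-variable identity theorem: in the first variable with the second
  fixed in \<open>V\<close>, then in the second with the first fixed at \<open>z\<close>.\<close>

lemma separately_holomorphic_identity:
  fixes f g :: "complex \<Rightarrow> complex \<Rightarrow> complex"
  assumes S: "open S" "connected S" and T: "open T" "connected T"
    and U: "open U" "U \<noteq> {}" "U \<subseteq> S" and V: "open V" "V \<noteq> {}" "V \<subseteq> T"
    and f: "\<And>w. w \<in> T \<Longrightarrow> (\<lambda>z. f z w) holomorphic_on S" "\<And>z. z \<in> S \<Longrightarrow> f z holomorphic_on T"
    and g: "\<And>w. w \<in> T \<Longrightarrow> (\<lambda>z. g z w) holomorphic_on S" "\<And>z. z \<in> S \<Longrightarrow> g z holomorphic_on T"
    and eq: "\<And>z w. z \<in> U \<Longrightarrow> w \<in> V \<Longrightarrow> f z w = g z w"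
    and z: "z \<in> S" and w: "w \<in> T"
  shows "f z w = g z w"
proof -
  have "f z v = g z v" if v: "v \<in> V" for v
    by (rule analytic_continuation_open[OF U(1) S(1) U(2) S(2) U(3), of "\<lambda>z. f z v" "\<lambda>z. g z v"])
       (use f(1) g(1) eq v V(3) z in auto)
  then show ?thesis
    by (rule analytic_continuation_open[OF V(1) T(1) V(2) T(2) V(3) f(2)[OF z] g(2)[OF z] _ w])
qed

text \<open>For \<open>a = b = 1\<close> this is the \<open>E\<close> of the overview; for
  \<open>a = 1 + z * R1 z\<close> and \<open>b = 1 + w * R2 w\<close> it is \<open>h_bifree\<close>
  at nonzero \<open>z\<close>, \<open>w\<close>. No \<open>1 / z\<close> or \<open>1 / w\<close>
  occurs, so it can be continued across the axes.\<close>

definition bicauchy ::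
    "(real \<times> real) measure \<Rightarrow> complex \<Rightarrow> complex \<Rightarrow> complex \<Rightarrow> complex \<Rightarrow> complex" where
  "bicauchy \<mu> a b z w = (LINT p|\<mu>. 1 / ((a - z * of_real (fst p)) * (b - w * of_real (snd p))))"

text \<open>Both factors are within 1/8 of 1, so their product is within
  \<open>1/64 + 1/4 = 17/64\<close> of 1 and has modulus at least \<open>47/64\<close>; its
  reciprocal is then within \<open>17/47 < 1/2\<close> of 1.\<close>

lemma bicauchy_kernel_bound:
  fixes a b z w :: complex and s u M :: real
  assumes a: "norm (a - 1) \<le> 1/16" and b: "norm (b - 1) \<le> 1/16"
    and z: "norm z * M \<le> 1/16" and w: "norm w * M \<le> 1/16" and s: "\<bar>s\<bar> \<le> M" and u: "\<bar>u\<bar> \<le> M"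
  shows "a - z * of_real s \<noteq> 0" "b - w * of_real u \<noteq> 0"
    and "norm (1 / ((a - z * of_real s) * (b - w * of_real u)) - 1) \<le> 1/2"
    and "norm (1 / ((a - z * of_real s) * (b - w * of_real u))) \<le> 2"
proof -
  define x where "x = a - z * of_real s"
  define y where "y = b - w * of_real u"
  have "norm z * \<bar>s\<bar> \<le> norm z * M" "norm w * \<bar>u\<bar> \<le> norm w * M"
    using s u by (auto intro: mult_left_mono)
  then have "norm (z * of_real s) \<le> 1/16" "norm (w * of_real u) \<le> 1/16"
    using z w by (auto simp: norm_mult)
  then have x: "norm (x - 1) \<le> 1/8" and y: "norm (y - 1) \<le> 1/8"
    using a b norm_triangle_ineq4[of "a - 1" "z * of_real s"] norm_triangle_ineq4[of "b - 1" "w * of_real u"]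
    by (auto simp: x_def y_def algebra_simps)
  have "norm (x * y - 1) = norm ((x - 1) * (y - 1) + ((x - 1) + (y - 1)))" by (simp add: algebra_simps)
  also have "\<dots> \<le> norm (x - 1) * norm (y - 1) + (norm (x - 1) + norm (y - 1))"
    by (rule order_trans[OF norm_triangle_ineq add_mono[OF _ norm_triangle_ineq]]) (simp add: norm_mult)
  also have "\<dots> \<le> 1/8 * (1/8) + (1/8 + 1/8)"
    by (intro add_mono mult_mono x y) auto
  finally have xy: "norm (x * y - 1) \<le> 17/64" by simp
  then have xy': "norm (x * y) \<ge> 47/64" using norm_triangle_ineq2[of 1 "1 - x * y"]
    by (simp add: norm_minus_commute)
  then have "x * y \<noteq> 0" by auto
  then show "a - z * of_real s \<noteq> 0" "b - w * of_real u \<noteq> 0" by (auto simp: x_def y_def)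
  have "1 / (x * y) - 1 = (1 - x * y) / (x * y)" using \<open>x * y \<noteq> 0\<close> by (simp add: diff_divide_distrib)
  then have "norm (1 / (x * y) - 1) = norm (x * y - 1) / norm (x * y)"
    by (simp only: norm_divide norm_minus_commute)
  also have "\<dots> \<le> (17/64) / (47/64)" by (intro frac_le xy xy') auto
  finally have *: "norm (1 / (x * y) - 1) \<le> 1/2" by simp
  then show "norm (1 / ((a - z * of_real s) * (b - w * of_real u)) - 1) \<le> 1/2"
    by (simp add: x_def y_def)
  have "norm (1 / (x * y)) \<le> 2" using * norm_triangle_ineq2[of "1 / (x * y)" 1] by simp
  then show "norm (1 / ((a - z * of_real s) * (b - w * of_real u))) \<le> 2"
    by (simp add: x_def y_def)
qed

section \<open>Holomorphy and nonvanishing of \<open>bicauchy\<close> for \<open>a\<close> and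
  \<open>b\<close> close to 1\<close>

context
  fixes \<mu> :: "(real \<times> real) measure" and M \<delta> :: real and a b :: "complex \<Rightarrow> complex"
  assumes \<mu>: "plane_law \<mu>" and supp: "AE p in \<mu>. \<bar>fst p\<bar> \<le> M \<and> \<bar>snd p\<bar> \<le> M"
    and \<delta>M: "\<delta> * M \<le> 1/16" and M: "M \<ge> 0"
    and a: "a holomorphic_on ball 0 \<delta>" "\<And>z. z \<in> ball 0 \<delta> \<Longrightarrow> norm (a z - 1) \<le> 1/16"
    and b: "b holomorphic_on ball 0 \<delta>" "\<And>z. z \<in> ball 0 \<delta> \<Longrightarrow> norm (b z - 1) \<le> 1/16"
begin

lemma bicauchy_measurable:
  "(\<lambda>p. 1 / ((c - z * complex_of_real (fst p)) * (d - w * complex_of_real (snd p)))) \<in> borel_measurable \<mu>"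
proof -
  have [measurable]: "fst \<in> borel_measurable \<mu>" "snd \<in> borel_measurable \<mu>"
    using plane_law_measurable[OF \<mu>] fst_snd_borel by auto
  show ?thesis by measurable
qed

lemma norm_mult_support: "z \<in> ball 0 \<delta> \<Longrightarrow> norm z * M \<le> 1/16" for z :: complex
proof -
  assume "z \<in> ball 0 \<delta>"
  then have "norm z * M \<le> \<delta> * M" using M by (intro mult_right_mono) auto
  then show ?thesis using \<delta>M by simp
qed

lemma bicauchy_integrable:
  assumes z: "z \<in> ball 0 \<delta>" and w: "w \<in> ball 0 \<delta>"
  shows "integrable \<mu> (\<lambda>p. 1 / ((a z - z * of_real (fst p)) * (b w - w * of_real (snd p))))"
proof -
  interpret prob_space \<mu> using \<mu> by (simp add: plane_law_def)
  show ?thesis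
  proof (rule integrable_const_bound)
    show "AE p in \<mu>. norm (1 / ((a z - z * of_real (fst p)) * (b w - w * of_real (snd p)))) \<le> 2"
      using supp
      by eventually_elim
         (rule bicauchy_kernel_bound(4)[OF a(2)[OF z] b(2)[OF w] norm_mult_support[OF z] norm_mult_support[OF w]]; simp)
  qed (rule bicauchy_measurable)
qed

text \<open>The kernel is almost surely within 1/2 of 1 and \<open>\<mu>\<close> has mass 1. The
  point is that the integral has no zeros on the bidisk, so its reciprocal is holomorphic.\<close>

lemma norm_bicauchy_minus_1:
  assumes z: "z \<in> ball 0 \<delta>" and w: "w \<in> ball 0 \<delta>"
  shows "norm (bicauchy \<mu> (a z) (b w) z w - 1) \<le> 1/2"
proof -
  interpret prob_space \<mu> using \<mu> by (simp add: plane_law_def)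
  let ?k = "\<lambda>p. 1 / ((a z - z * of_real (fst p)) * (b w - w * of_real (snd p)))"
  have int: "integrable \<mu> (\<lambda>p. ?k p - 1)" using bicauchy_integrable[OF z w] by simp
  have "bicauchy \<mu> (a z) (b w) z w - 1 = (LINT p|\<mu>. ?k p - 1)"
    unfolding bicauchy_def using bicauchy_integrable[OF z w] prob_space by simp
  also have "norm \<dots> \<le> (LINT p|\<mu>. norm (?k p - 1))" by (rule integral_norm_bound)
  also have "\<dots> \<le> 1/2"
  proof (rule integral_le_const)
    show "integrable \<mu> (\<lambda>p. norm (?k p - 1))" using int by (rule integrable_norm)
    show "AE p in \<mu>. norm (?k p - 1) \<le> 1/2"
      using supp
      by eventually_elim
         (rule bicauchy_kernel_bound(3)[OF a(2)[OF z] b(2)[OF w] norm_mult_support[OF z] norm_mult_support[OF w]]; simp)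
  qed
  finally show ?thesis .
qed

lemma holomorphic_bicauchy:
  shows "w \<in> ball 0 \<delta> \<Longrightarrow> (\<lambda>z. bicauchy \<mu> (a z) (b w) z w) holomorphic_on ball 0 \<delta>"
    and "z \<in> ball 0 \<delta> \<Longrightarrow> (\<lambda>w. bicauchy \<mu> (a z) (b w) z w) holomorphic_on ball 0 \<delta>"
proof -
  interpret prob_space \<mu> using \<mu> by (simp add: plane_law_def)
  define K where "K = {p::real \<times> real. \<bar>fst p\<bar> \<le> M \<and> \<bar>snd p\<bar> \<le> M}"
  have K: "AE p in \<mu>. p \<in> K" using supp by (simp add: K_def)
  have bounds: "a z - z * of_real (fst p) \<noteq> 0" "b w - w * of_real (snd p) \<noteq> 0"
      "norm (1 / ((a z - z * of_real (fst p)) * (b w - w * of_real (snd p)))) \<le> 2"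
    if "z \<in> ball 0 \<delta>" "w \<in> ball 0 \<delta>" "p \<in> K" for z w p
    using bicauchy_kernel_bound(1,2,4)[OF a(2)[OF that(1)] b(2)[OF that(2)]
        norm_mult_support[OF that(1)] norm_mult_support[OF that(2)]] that(3)
    by (auto simp: K_def)
  show "(\<lambda>z. bicauchy \<mu> (a z) (b w) z w) holomorphic_on ball 0 \<delta>" if w: "w \<in> ball 0 \<delta>"
    unfolding bicauchy_def
    by (rule holomorphic_on_lebesgue_integral_bounded[where K = K and B = 2,
          OF finite_measure_axioms open_ball K bicauchy_measurable])
       (use bounds w in \<open>auto intro!: holomorphic_intros a(1)\<close>)
  show "(\<lambda>w. bicauchy \<mu> (a z) (b w) z w) holomorphic_on ball 0 \<delta>" if z: "z \<in> ball 0 \<delta>"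
    unfolding bicauchy_def
    by (rule holomorphic_on_lebesgue_integral_bounded[where K = K and B = 2,
          OF finite_measure_axioms open_ball K bicauchy_measurable])
       (use bounds z in \<open>auto intro!: holomorphic_intros b(1)\<close>)
qed

end

lemma h_bifree_eq_bicauchy:
  assumes "z \<noteq> 0" "w \<noteq> 0"
  shows "h_bifree \<mu> R1 R2 z w = bicauchy \<mu> (1 + z * R1 z) (1 + w * R2 w) z w"
proof -
  have "1 / ((1 + z * R1 z - z * s) * (1 + w * R2 w - w * u))
      = 1 / ((1 / z + R1 z - s) * (1 / w + R2 w - u)) / (z * w)" for s u
  proof -
    have "1 + z * R1 z - z * s = z * (1 / z + R1 z - s)" "1 + w * R2 w - w * u = w * (1 / w + R2 w - u)"
      using assms by (simp_all add: field_simps)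
    then show ?thesis by (simp add: divide_simps mult_ac)
  qed
  then show ?thesis
    by (simp add: h_bifree_def cauchy2_def bicauchy_def case_prod_unfold del: divide_divide_eq_left)
qed

text \<open>Pulling \<open>a\<close> and \<open>b\<close> out of the factors trades them for a
  change of the evaluation point, which is how the R-transform formula becomes a statement about the
  Cauchy transform itself.\<close>

lemma bicauchy_rescale:
  assumes "a \<noteq> 0" "b \<noteq> 0"
  shows "bicauchy \<mu> 1 1 (z / a) (w / b) = a * b * bicauchy \<mu> a b z w"
proof -
  have "1 / ((1 - z / a * s) * (1 - w / b * u)) = a * b * (1 / ((a - z * s) * (b - w * u)))" for s u
  proof -
    have eq: "1 - z / a * s = (a - z * s) / a" "1 - w / b * u = (b - w * u) / b"
      using assms by (simp_all add: field_simps)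
    have "1 / ((x / a) * (y / b)) = a * b * (1 / (x * y))" for x y by simp
    then show ?thesis unfolding eq .
  qed
  then show ?thesis unfolding bicauchy_def by (simp only: integral_mult_right_zero)
qed

lemma cauchy2_inv_eq_bicauchy: "cauchy2_inv \<mu> z w = z * w * bicauchy \<mu> 1 1 z w"
proof -
  have "cauchy2_inv_integrand z w = (\<lambda>p. z * w * (1 / ((1 - z * of_real (fst p)) * (1 - w * of_real (snd p)))))"
    by (simp add: cauchy2_inv_integrand_def case_prod_unfold)
  then show ?thesis unfolding cauchy2_inv_def bicauchy_def by (simp only: integral_mult_right_zero)
qed

text \<open>Passing through the intermediate point \<open>(z, w')\<close> reduces this to
  one-variable Cauchy estimates. It supplies the joint continuity of \<open>P\<close> along moving
  points.\<close>

lemma separately_holomorphic_Lipschitz: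
  fixes P :: "complex \<Rightarrow> complex \<Rightarrow> complex"
  assumes \<delta>: "\<delta> > 0"
    and holz: "\<And>w. w \<in> ball 0 \<delta> \<Longrightarrow> (\<lambda>z. P z w) holomorphic_on ball 0 \<delta>"
    and holw: "\<And>z. z \<in> ball 0 \<delta> \<Longrightarrow> P z holomorphic_on ball 0 \<delta>"
    and B: "\<And>z w. z \<in> ball 0 \<delta> \<Longrightarrow> w \<in> ball 0 \<delta> \<Longrightarrow> norm (P z w) \<le> B"
    and zw: "z \<in> ball 0 (\<delta>/2)" "z' \<in> ball 0 (\<delta>/2)" "w \<in> ball 0 (\<delta>/2)" "w' \<in> ball 0 (\<delta>/2)"
  shows "norm (P z' w' - P z w) \<le> 4 * B / \<delta> * (norm (z' - z) + norm (w' - w))"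
proof -
  have "z \<in> ball 0 \<delta>" "w' \<in> ball 0 \<delta>" using zw \<delta> by auto
  then have "norm (P z' w' - P z w') \<le> 4 * B / \<delta> * norm (z' - z)"
      "norm (P z w' - P z w) \<le> 4 * B / \<delta> * norm (w' - w)"
    using norm_diff_le_of_holomorphic_bounded[OF holz \<delta> B zw(2,1)]
      norm_diff_le_of_holomorphic_bounded[OF holw \<delta> B zw(4,3)] by auto
  then show ?thesis
    using norm_triangle_ineq[of "P z' w' - P z w'" "P z w' - P z w"] by (simp add: algebra_simps)
qed

text \<open>Solving \<open>z' = z (1 + t A z')\<close> converts the relation for the rescaled arguments into an explicit
  formula for \<open>E t z w\<close>, in which only the point \<open>(z', w')\<close>, converging to \<open>(z, w)\<close>, depends on \<open>t\<close>
  implicitly.\<close>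

lemma rescaled_relation_derivative:
  fixes E :: "real \<Rightarrow> complex \<Rightarrow> complex \<Rightarrow> complex" and A B :: "complex \<Rightarrow> complex"
    and P :: "complex \<Rightarrow> complex \<Rightarrow> complex"
  assumes \<delta>: "\<delta> > 0"
    and A: "A holomorphic_on ball 0 \<delta>" "\<And>z. z \<in> ball 0 \<delta> \<Longrightarrow> norm (A z) \<le> 1/16"
    and B: "B holomorphic_on ball 0 \<delta>" "\<And>z. z \<in> ball 0 \<delta> \<Longrightarrow> norm (B z) \<le> 1/16"
    and holz: "\<And>w. w \<in> ball 0 \<delta> \<Longrightarrow> (\<lambda>z. P z w) holomorphic_on ball 0 \<delta>"
    and holw: "\<And>z. z \<in> ball 0 \<delta> \<Longrightarrow> P z holomorphic_on ball 0 \<delta>"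
    and C: "\<And>z w. z \<in> ball 0 \<delta> \<Longrightarrow> w \<in> ball 0 \<delta> \<Longrightarrow> norm (P z w) \<le> C"
    and rel: "\<And>t z w. 0 \<le> t \<Longrightarrow> t \<le> 1 \<Longrightarrow> z \<in> ball 0 \<delta> \<Longrightarrow> w \<in> ball 0 \<delta> \<Longrightarrow>
      E t (z / (1 + of_real t * A z)) (w / (1 + of_real t * B w)) * (1 + of_real t * (A z + B w - P z w))
        = (1 + of_real t * A z) * (1 + of_real t * B w)"
    and z: "z \<in> ball 0 (\<delta>/4)" and w: "w \<in> ball 0 (\<delta>/4)"
  shows "E 0 z w = 1" and "((\<lambda>t. (E t z w - 1) / of_real t) \<longlongrightarrow> P z w) (at_right 0)"
proof -
  \<comment> \<open>At \<open>t = 0\<close> nothing is rescaled and the relation reads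
    \<open>E 0 z w = 1\<close>; this takes the place of identifying the law at time 0 as a point
    mass.\<close>
  show "E 0 z w = 1" using rel[of 0 z w] z w \<delta> by auto
  \<comment> \<open>For \<open>z\<close> in the disc of radius \<open>\<delta>/4\<close> the map
    preserves the disc of radius \<open>\<delta>/3\<close>, because
    \<open>1/4 * 17/16 < 1/3\<close>. The solution found is within \<open>t * norm z\<close> of
    \<open>z\<close>, so an arbitrary choice for each \<open>t\<close> converges to
    \<open>z\<close>.\<close>
  have solve: "\<exists>z'\<in>cball 0 (\<delta>/3). z' = z * (1 + of_real t * F z') \<and> norm (z' - z) \<le> t * norm z"
    if F: "F holomorphic_on ball 0 \<delta>" "\<And>z. z \<in> ball 0 \<delta> \<Longrightarrow> norm (F z) \<le> 1/16"
      and t: "0 \<le> t" "t \<le> 1" and z: "z \<in> ball 0 (\<delta>/4)" for F t and z :: complex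
  proof -
    have Fb: "norm (of_real t * F z') \<le> t * (1/16)" if "z' \<in> cball 0 (\<delta>/3)" for z'
    proof -
      have "t * norm (F z') \<le> t * (1/16)" using that \<delta> t by (intro mult_left_mono F(2)) auto
      then show ?thesis using t by (simp add: norm_mult)
    qed
    obtain z' where z': "z' \<in> cball 0 (\<delta>/3)" "z * (1 + of_real t * F z') = z'"
    proof (rule brouwer_ball[of "\<delta>/3" 0 "\<lambda>z'. z * (1 + of_real t * F z')"])
      show "continuous_on (cball 0 (\<delta>/3)) (\<lambda>z'. z * (1 + of_real t * F z'))"
        using \<delta> by (intro continuous_intros
          holomorphic_on_imp_continuous_on[OF holomorphic_on_subset[OF F(1)]]) auto
      show "(\<lambda>z'. z * (1 + of_real t * F z')) \<in> cball 0 (\<delta>/3) \<rightarrow> cball 0 (\<delta>/3)"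
      proof
        fix z' :: complex assume "z' \<in> cball 0 (\<delta>/3)"
        from Fb[OF this] have "norm (1 + of_real t * F z') \<le> 17/16"
          using norm_triangle_ineq[of 1 "of_real t * F z'"] t by simp
        then have "norm z * norm (1 + of_real t * F z') \<le> (\<delta>/4) * (17/16)"
          using z \<delta> by (intro mult_mono) auto
        then show "z * (1 + of_real t * F z') \<in> cball 0 (\<delta>/3)"
          using \<delta> by (simp add: norm_mult)
      qed
    qed (use \<delta> in auto)
    have "z' - z = z * (of_real t * F z')" using z'(2) by (simp add: algebra_simps)
    then have "norm (z' - z) = norm z * norm (of_real t * F z')" by (simp only: norm_mult)
    also have "\<dots> \<le> norm z * t"
      using Fb[OF z'(1)] t by (intro mult_left_mono) auto
    finally show ?thesis using z' by (intro bexI[of _ z']) (auto simp: mult.commute)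
  qed
  \<comment> \<open>The guard makes the claim true for every real \<open>t\<close>, which lets a
    choice function be total.\<close>
  have "\<exists>z'. t \<in> {0..1} \<longrightarrow> z' \<in> cball 0 (\<delta>/3) \<and> z' = z * (1 + of_real t * A z') \<and> norm (z' - z) \<le> t * norm z" for t
    using solve[OF A _ _ z, of t] by (cases "t \<in> {0..1}") auto
  then obtain Z where Z: "\<And>t. t \<in> {0..1} \<Longrightarrow> Z t \<in> cball 0 (\<delta>/3)"
      "\<And>t. t \<in> {0..1} \<Longrightarrow> Z t = z * (1 + of_real t * A (Z t))"
      "\<And>t. t \<in> {0..1} \<Longrightarrow> norm (Z t - z) \<le> t * norm z" by metis
  have "\<exists>w'. t \<in> {0..1} \<longrightarrow> w' \<in> cball 0 (\<delta>/3) \<and> w' = w * (1 + of_real t * B w') \<and> norm (w' - w) \<le> t * norm w" for t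
    using solve[OF B _ _ w, of t] by (cases "t \<in> {0..1}") auto
  then obtain W where W: "\<And>t. t \<in> {0..1} \<Longrightarrow> W t \<in> cball 0 (\<delta>/3)"
      "\<And>t. t \<in> {0..1} \<Longrightarrow> W t = w * (1 + of_real t * B (W t))"
      "\<And>t. t \<in> {0..1} \<Longrightarrow> norm (W t - w) \<le> t * norm w" by metis
  have ev: "eventually (\<lambda>t::real. t \<in> {0<..1}) (at_right 0)"
    by (intro eventually_at_rightI[of 0 1]) auto
  have lim0: "((\<lambda>t. t * c) \<longlongrightarrow> 0) (at_right 0)" for c :: real
    by (auto intro!: tendsto_eq_intros)
  have Zl: "(Z \<longlongrightarrow> z) (at_right 0)"
    by (rule LIM_zero_cancel, rule Lim_null_comparison[OF _ lim0[of "norm z"]],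
        rule eventually_mono[OF ev]) (use Z(3) in auto)
  have Wl: "(W \<longlongrightarrow> w) (at_right 0)"
    by (rule LIM_zero_cancel, rule Lim_null_comparison[OF _ lim0[of "norm w"]],
        rule eventually_mono[OF ev]) (use W(3) in auto)
  have zb: "z \<in> ball 0 \<delta>" "w \<in> ball 0 \<delta>" using z w \<delta> by auto
  have Al: "((\<lambda>t. A (Z t)) \<longlongrightarrow> A z) (at_right 0)"
    using A(1) zb Zl by (metis continuous_on_eq_continuous_at holomorphic_on_imp_continuous_on isCont_tendsto_compose open_ball)
  have Bl: "((\<lambda>t. B (W t)) \<longlongrightarrow> B w) (at_right 0)"
    using B(1) zb Wl by (metis continuous_on_eq_continuous_at holomorphic_on_imp_continuous_on isCont_tendsto_compose open_ball)
  have Pl: "((\<lambda>t. P (Z t) (W t)) \<longlongrightarrow> P z w) (at_right 0)"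
  proof (rule LIM_zero_cancel, rule Lim_null_comparison)
    show "eventually (\<lambda>t. norm (P (Z t) (W t) - P z w) \<le> 4 * C / \<delta> * (norm (Z t - z) + norm (W t - w))) (at_right 0)"
      using ev
    proof eventually_elim
      case (elim t)
      then have "Z t \<in> cball 0 (\<delta>/3)" "W t \<in> cball 0 (\<delta>/3)" using Z(1) W(1) by auto
      then show ?case using z w \<delta>
        by (intro separately_holomorphic_Lipschitz[OF \<delta> holz holw C]) auto
    qed
    have "((\<lambda>t. 4 * C / \<delta> * (norm (Z t - z) + norm (W t - w))) \<longlongrightarrow> 4 * C / \<delta> * (norm (z - z) + norm (w - w))) (at_right 0)"
      by (intro tendsto_intros Zl Wl)
    then show "((\<lambda>t. 4 * C / \<delta> * (norm (Z t - z) + norm (W t - w))) \<longlongrightarrow> 0) (at_right 0)" by simp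
  qed
  define Q where "Q = (\<lambda>t. A (Z t) + B (W t) - P (Z t) (W t))"
  have tl: "((\<lambda>t. complex_of_real t) \<longlongrightarrow> of_real 0) (at_right 0)"
    by (intro tendsto_intros)
  \<comment> \<open>In \<open>(1 + t A) (1 + t B) - (1 + t Q)\<close> the terms \<open>A + B\<close>
    cancel and \<open>t (P + t A B)\<close> remains. The quotient below is therefore
    \<open>(E - 1) / t\<close>, free of any division by \<open>t\<close>.\<close>
  have "((\<lambda>t. (P (Z t) (W t) + of_real t * (A (Z t) * B (W t))) / (1 + of_real t * Q t))
      \<longlongrightarrow> (P z w + of_real 0 * (A z * B w)) / (1 + of_real 0 * (A z + B w - P z w))) (at_right 0)"
    unfolding Q_def by (intro tendsto_intros tl Al Bl Pl) auto
  then have l: "((\<lambda>t. (P (Z t) (W t) + of_real t * (A (Z t) * B (W t))) / (1 + of_real t * Q t))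
      \<longlongrightarrow> P z w) (at_right 0)" by simp
  show "((\<lambda>t. (E t z w - 1) / of_real t) \<longlongrightarrow> P z w) (at_right 0)"
  proof (rule Lim_transform_eventually[OF l], use ev in eventually_elim)
    fix t :: real assume t: "t \<in> {0<..1}"
    then have t': "t \<in> {0..1}" by auto
    have ZW: "Z t \<in> ball 0 \<delta>" "W t \<in> ball 0 \<delta>" using Z(1)[OF t'] W(1)[OF t'] \<delta> by auto
    have small: "1 + of_real t * c \<noteq> 0" if "norm c \<le> 1/16" for c :: complex
    proof
      assume "1 + of_real t * c = 0"
      then have "of_real t * c = - 1" by (simp add: eq_neg_iff_add_eq_0 add.commute)
      then have "t * norm c = 1" using t by (metis abs_of_nonneg atLeastAtMost_iff norm_minus_cancel norm_mult norm_of_real norm_one t')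
      moreover have "t * norm c \<le> 1 * (1/16)" using t that by (intro mult_mono) auto
      ultimately show False by simp
    qed
    have nA: "1 + of_real t * A (Z t) \<noteq> 0" and nB: "1 + of_real t * B (W t) \<noteq> 0"
      using small A(2)[OF ZW(1)] B(2)[OF ZW(2)] by auto
    have "Z t / (1 + of_real t * A (Z t)) = z" "W t / (1 + of_real t * B (W t)) = w"
      using Z(2)[OF t'] W(2)[OF t'] nA nB by (simp_all add: divide_eq_eq)
    with rel[OF _ _ ZW, of t] t
    have e: "E t z w * (1 + of_real t * Q t) = (1 + of_real t * A (Z t)) * (1 + of_real t * B (W t))"
      by (simp add: Q_def)
    then have nQ: "1 + of_real t * Q t \<noteq> 0" using nA nB by (metis mult_eq_0_iff)
    have "E t z w = (1 + of_real t * A (Z t)) * (1 + of_real t * B (W t)) / (1 + of_real t * Q t)"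
      using e nQ by (simp add: eq_divide_eq)
    also have "\<dots> - 1 = ((1 + of_real t * A (Z t)) * (1 + of_real t * B (W t)) - (1 + of_real t * Q t)) / (1 + of_real t * Q t)"
      using nQ by (simp add: diff_divide_distrib)
    also have "(1 + of_real t * A (Z t)) * (1 + of_real t * B (W t)) - (1 + of_real t * Q t)
        = of_real t * (P (Z t) (W t) + of_real t * (A (Z t) * B (W t)))"
      by (simp add: Q_def algebra_simps)
    finally show "(P (Z t) (W t) + of_real t * (A (Z t) * B (W t))) / (1 + of_real t * Q t)
        = (E t z w - 1) / of_real t" using t by simp
  qed
qed

subsection \<open>Continuation from product domains\<close>

lemma small_near_zero:
  fixes r :: "complex \<Rightarrow> complex"
  assumes "r holomorphic_on ball 0 \<rho>" "\<rho> > 0"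
  obtains \<delta> where "\<delta> > 0" "\<delta> \<le> \<rho>" "\<And>z. z \<in> ball 0 \<delta> \<Longrightarrow> norm (z * r z) \<le> 1/16"
proof -
  have "isCont r 0"
    using assms by (meson centre_in_ball continuous_on_eq_continuous_at holomorphic_on_imp_continuous_on open_ball)
  then have "isCont (\<lambda>z. z * r z) 0" by (intro continuous_intros)
  then have "((\<lambda>z. z * r z) \<longlongrightarrow> 0) (at 0)" by (simp add: isCont_def)
  from tendstoD[OF this, of "1/16"]
  obtain d where d: "d > 0" "\<And>z. z \<noteq> 0 \<Longrightarrow> dist z 0 < d \<Longrightarrow> dist (z * r z) 0 < 1/16"
    by (auto simp: eventually_at simp del: dist_0_norm)
  show ?thesis
  proof
    show "min d \<rho> > 0" "min d \<rho> \<le> \<rho>" using d assms by auto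
    show "norm (z * r z) \<le> 1/16" if "z \<in> ball 0 (min d \<rho>)" for z
    proof (cases "z = 0")
      case False
      then have "dist (z * r z) 0 < 1/16" using that by (intro d(2)) auto
      then show ?thesis by (simp only: dist_norm diff_zero less_imp_le)
    qed simp
  qed
qed

section \<open>Supports of plane laws and of their marginals\<close>

lemma AE_plane_of_marginals:
  assumes \<mu>: "plane_law \<mu>" and 1: "AE x in marginal1 \<mu>. \<bar>x\<bar> \<le> M1" and 2: "AE x in marginal2 \<mu>. \<bar>x\<bar> \<le> M2"
    and "M1 \<le> M" "M2 \<le> M"
  shows "AE p in \<mu>. \<bar>fst p\<bar> \<le> M \<and> \<bar>snd p\<bar> \<le> M"
proof -
  have m: "fst \<in> borel_measurable \<mu>" "snd \<in> borel_measurable \<mu>"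
    using plane_law_measurable[OF \<mu>] fst_snd_borel by auto
  have "AE p in \<mu>. \<bar>fst p\<bar> \<le> M1" "AE p in \<mu>. \<bar>snd p\<bar> \<le> M2"
    using AE_distrD[OF m(1) 1[unfolded marginal1_def]] AE_distrD[OF m(2) 2[unfolded marginal2_def]] by auto
  then show ?thesis by eventually_elim (use assms(4,5) in auto)
qed

lemma AE_marginals_of_plane:
  assumes \<mu>: "plane_law \<mu>" and AE: "AE p in \<mu>. \<bar>fst p\<bar> \<le> M \<and> \<bar>snd p\<bar> \<le> M"
  shows "AE x in marginal1 \<mu>. \<bar>x\<bar> \<le> M" "AE x in marginal2 \<mu>. \<bar>x\<bar> \<le> M"
proof -
  have m: "fst \<in> borel_measurable \<mu>" "snd \<in> borel_measurable \<mu>"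
    using plane_law_measurable[OF \<mu>] fst_snd_borel by auto
  have s: "{x \<in> space borel. \<bar>x::real\<bar> \<le> M} \<in> sets borel" by measurable
  show "AE x in marginal1 \<mu>. \<bar>x\<bar> \<le> M" "AE x in marginal2 \<mu>. \<bar>x\<bar> \<le> M"
    unfolding marginal1_def marginal2_def AE_distr_iff[OF m(1) s] AE_distr_iff[OF m(2) s]
    using AE by auto
qed

lemma compactly_supported_AE_bounded:
  assumes \<mu>: "plane_law \<mu>" and "compactly_supported \<mu>"
  obtains M where "M > 0" "AE p in \<mu>. \<bar>fst p\<bar> \<le> M \<and> \<bar>snd p\<bar> \<le> M"
proof -
  from assms obtain K where K: "compact K" "emeasure \<mu> (UNIV - K) = 0" by (auto simp: compactly_supported_def)
  then obtain M where M: "M > 0" "\<And>p. p \<in> K \<Longrightarrow> norm p \<le> M"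
    using compact_imp_bounded bounded_pos by metis
  have "K \<in> sets borel" using K by (simp add: borel_compact)
  then have "UNIV - K \<in> sets \<mu>" using plane_law_sets[OF \<mu>] by auto
  then have "AE p in \<mu>. p \<notin> UNIV - K" using K(2) by (intro AE_not_in) (auto simp: null_sets_def)
  then have "AE p in \<mu>. \<bar>fst p\<bar> \<le> M \<and> \<bar>snd p\<bar> \<le> M"
  proof eventually_elim
    case (elim p)
    then have "norm p \<le> M" using M(2) by simp
    then show ?case using norm_fst_le[of "fst p" "snd p"] norm_snd_le[of "snd p" "fst p"] by simp
  qed
  with M(1) show ?thesis using that by blast
qed

text \<open>The scalar \<open>t\<close> covers both \<open>\<nu>\<close> itself, with
  \<open>t = 1\<close>, and the laws of the semigroup.\<close>

lemma bifree_R_with_eq_bicauchy: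
  assumes R: "bifree_R_with \<mu> \<alpha> \<beta> R1 R2 R" and z: "z \<in> stolz_sym \<alpha> \<beta>" and w: "w \<in> stolz_sym \<alpha> \<beta>"
    and "R1 z = t * r1 z" "R2 w = t * r2 w"
  defines "H \<equiv> bicauchy \<mu> (1 + t * (z * r1 z)) (1 + t * (w * r2 w)) z w"
  shows "H \<noteq> 0" and "R z w = t * (z * r1 z) + t * (w * r2 w) + (1 - 1 / H)"
proof -
  have "z \<noteq> 0" "w \<noteq> 0" using z w by (auto simp: mem_stolz_sym_iff)
  then have "h_bifree \<mu> R1 R2 z w = H"
    using assms(4,5) by (simp add: h_bifree_eq_bicauchy H_def mult_ac)
  then show "H \<noteq> 0" "R z w = t * (z * r1 z) + t * (w * r2 w) + (1 - 1 / H)"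
    using R z w assms(4,5) by (auto simp: bifree_R_with_def mult_ac)
qed

text \<open>The R-transform formula gives the relation on an angle whose size depends on the law.
  Both sides are holomorphic on the full bidisk of radius \<open>\<delta>\<close>, which
  \<open>M\<close>, \<open>r1\<close>, \<open>r2\<close> control, so the identity theorem removes
  that dependence. As discs are connected, the lower angle alone can serve as starting set in both
  variables.\<close>

lemma bicauchy_relation:
  fixes r1 r2 :: "complex \<Rightarrow> complex" and P :: "complex \<Rightarrow> complex \<Rightarrow> complex" and t :: real
  assumes \<delta>: "\<delta> > 0" and \<mu>: "plane_law \<mu>" and supp: "AE p in \<mu>. \<bar>fst p\<bar> \<le> M \<and> \<bar>snd p\<bar> \<le> M"
    and \<delta>M: "\<delta> * M \<le> 1/16" and M: "M \<ge> 0"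
    and r1: "r1 holomorphic_on ball 0 \<delta>" "\<And>z. z \<in> ball 0 \<delta> \<Longrightarrow> norm (z * r1 z) \<le> 1/16"
    and r2: "r2 holomorphic_on ball 0 \<delta>" "\<And>z. z \<in> ball 0 \<delta> \<Longrightarrow> norm (z * r2 z) \<le> 1/16"
    and Pz: "\<And>w. w \<in> ball 0 \<delta> \<Longrightarrow> (\<lambda>z. P z w) holomorphic_on ball 0 \<delta>"
    and Pw: "\<And>z. z \<in> ball 0 \<delta> \<Longrightarrow> P z holomorphic_on ball 0 \<delta>"
    and t: "0 \<le> t" "t \<le> 1" and \<alpha>: "\<alpha> > 0" and \<beta>: "\<beta> > 0"
    and R: "bifree_R_with \<mu> \<alpha> \<beta> R1 R2 (\<lambda>z w. of_real t * P z w)"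
    and R1: "\<And>z. z \<in> stolz_sym \<alpha> \<beta> \<Longrightarrow> R1 z = of_real t * r1 z"
    and R2: "\<And>z. z \<in> stolz_sym \<alpha> \<beta> \<Longrightarrow> R2 z = of_real t * r2 z"
    and z: "z \<in> ball 0 \<delta>" and w: "w \<in> ball 0 \<delta>"
  shows "bicauchy \<mu> (1 + of_real t * (z * r1 z)) (1 + of_real t * (w * r2 w)) z w
      * (1 + of_real t * (z * r1 z + w * r2 w - P z w)) = 1"
proof -
  have small: "norm ((1 + of_real t * (z * r z)) - 1) \<le> 1/16" if "norm (z * r z) \<le> 1/16"
    for z and r :: "complex \<Rightarrow> complex"
  proof -
    have "t * norm (z * r z) \<le> 1 * (1/16)" using t that by (intro mult_mono) auto
    then show ?thesis using t by (simp add: norm_mult)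
  qed
  note hol = holomorphic_bicauchy[OF \<mu> supp \<delta>M M, of "\<lambda>z. 1 + of_real t * (z * r1 z)" "\<lambda>z. 1 + of_real t * (z * r2 z)"]
  obtain \<gamma> where \<gamma>: "0 < \<gamma>" "\<gamma> \<le> \<beta>" and ball: "stolz_sym \<alpha> \<gamma> \<subseteq> ball 0 \<delta>"
    using stolz_sym_subset_ball[OF \<alpha> \<beta> \<delta>] .
  have sub: "stolz \<alpha> \<gamma> \<subseteq> stolz_sym \<alpha> \<gamma>" by (auto simp: stolz_sym_def)
  show ?thesis
  proof (rule separately_holomorphic_identity[where S = "ball 0 \<delta>" and T = "ball 0 \<delta>"
        and U = "stolz \<alpha> \<gamma>" and V = "stolz \<alpha> \<gamma>" and g = "\<lambda>_ _. 1"
        and f = "\<lambda>z w. bicauchy \<mu> (1 + of_real t * (z * r1 z)) (1 + of_real t * (w * r2 w)) z w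
          * (1 + of_real t * (z * r1 z + w * r2 w - P z w))"])
    fix z w assume "z \<in> stolz \<alpha> \<gamma>" "w \<in> stolz \<alpha> \<gamma>"
    then have zw: "z \<in> stolz_sym \<alpha> \<beta>" "w \<in> stolz_sym \<alpha> \<beta>"
      using sub stolz_sym_mono[of \<alpha> \<alpha> \<gamma> \<beta>] \<gamma> by auto
    define H where "H = bicauchy \<mu> (1 + of_real t * (z * r1 z)) (1 + of_real t * (w * r2 w)) z w"
    have "H \<noteq> 0" "of_real t * P z w = of_real t * (z * r1 z) + of_real t * (w * r2 w) + (1 - 1 / H)"
      using bifree_R_with_eq_bicauchy[of \<mu> \<alpha> \<beta> R1 R2 _ z w "of_real t" r1 r2, OF R zw R1[OF zw(1)] R2[OF zw(2)]]
      unfolding H_def by auto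
    then have "1 + of_real t * (z * r1 z + w * r2 w - P z w) = 1 / H"
      by (simp add: algebra_simps)
    then have "H * (1 + of_real t * (z * r1 z + w * r2 w - P z w)) = 1"
      using \<open>H \<noteq> 0\<close> by simp
    then show "bicauchy \<mu> (1 + of_real t * (z * r1 z)) (1 + of_real t * (w * r2 w)) z w
        * (1 + of_real t * (z * r1 z + w * r2 w - P z w)) = 1"
      unfolding H_def .
  qed (use z w \<alpha> \<gamma> ball sub in \<open>auto intro!: holomorphic_intros hol r1 r2 Pz Pw small
        simp: open_stolz stolz_nonempty simp del: add_diff_cancel_left'\<close>)
qed

section \<open>From the extension off the real axes to a bidisk\<close>

lemma open_stolz_sym: "open (stolz_sym \<alpha> \<beta>)"
proof -
  have "stolz_sym \<alpha> \<beta> = {z. Im z \<noteq> 0 \<and> \<bar>Re z\<bar> < \<alpha> * \<bar>Im z\<bar> \<and> \<bar>Im z\<bar> < \<beta>}"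
    using mem_stolz_sym_iff by blast
  also have "open \<dots>"
    by (intro open_Collect_conj open_Collect_less open_Collect_neq continuous_intros)
  finally show ?thesis .
qed

lemma holomorphic2_on_sections:
  assumes R: "holomorphic2_on R (S \<times> T)"
  shows "w \<in> T \<Longrightarrow> (\<lambda>z. R z w) holomorphic_on S" and "z \<in> S \<Longrightarrow> R z holomorphic_on T"
proof -
  show "(\<lambda>z. R z w) holomorphic_on S" if w: "w \<in> T"
    unfolding holomorphic_on_def
  proof
    fix z assume z: "z \<in> S"
    with w R obtain a b where d: "((\<lambda>(z, w). R z w) has_derivative (\<lambda>(h, k). a * h + b * k)) (at (z, w) within S \<times> T)"
      unfolding holomorphic2_on_def by blast
    have "((\<lambda>z. (z, w)) has_derivative (\<lambda>h. (h, 0))) (at z within S)"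
      by (intro derivative_intros)
    moreover have "((\<lambda>(z, w). R z w) has_derivative (\<lambda>(h, k). a * h + b * k)) (at (z, w) within (\<lambda>z. (z, w)) ` S)"
      by (rule has_derivative_subset[OF d]) (use w in auto)
    ultimately have "((\<lambda>x. (\<lambda>(z, w). R z w) (x, w)) has_derivative (\<lambda>x. (\<lambda>(h, k). a * h + b * k) (x, 0))) (at z within S)"
      by (rule has_derivative_in_compose)
    then show "(\<lambda>z. R z w) field_differentiable at z within S"
      by (auto simp: field_differentiable_def has_field_derivative_def)
  qed
  show "R z holomorphic_on T" if z: "z \<in> S"
    unfolding holomorphic_on_def
  proof
    fix w assume w: "w \<in> T"
    with z R obtain a b where d: "((\<lambda>(z, w). R z w) has_derivative (\<lambda>(h, k). a * h + b * k)) (at (z, w) within S \<times> T)"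
      unfolding holomorphic2_on_def by blast
    have "((\<lambda>w. (z, w)) has_derivative (\<lambda>h. (0, h))) (at w within T)"
      by (intro derivative_intros)
    moreover have "((\<lambda>(z, w). R z w) has_derivative (\<lambda>(h, k). a * h + b * k)) (at (z, w) within (\<lambda>w. (z, w)) ` T)"
      by (rule has_derivative_subset[OF d]) (use z in auto)
    ultimately have "((\<lambda>x. (\<lambda>(z, w). R z w) (z, x)) has_derivative (\<lambda>x. (\<lambda>(h, k). a * h + b * k) (0, x))) (at w within T)"
      by (rule has_derivative_in_compose)
    then show "R z field_differentiable at w within T"
      by (auto simp: field_differentiable_def has_field_derivative_def)
  qed
qed

text \<open>Off the real axes the bidisk falls into four components, and continuation must run
  inside each one. Every component meets the product domain because \<open>stolz_sym\<close>
  contains both an angle and its reflection.\<close>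

lemma extension_eq_near_origin:
  assumes R: "holomorphic2_on R ((- \<real>) \<times> (- \<real>))"
    and Pz: "\<And>w. w \<in> ball 0 \<delta> \<Longrightarrow> (\<lambda>z. P z w) holomorphic_on ball 0 \<delta>"
    and Pw: "\<And>z. z \<in> ball 0 \<delta> \<Longrightarrow> P z holomorphic_on ball 0 \<delta>"
    and \<alpha>: "\<alpha> > 0" and \<gamma>: "\<gamma> > 0" and ball: "stolz_sym \<alpha> \<gamma> \<subseteq> ball 0 \<delta>"
    and eq: "\<And>z w. z \<in> stolz_sym \<alpha> \<gamma> \<Longrightarrow> w \<in> stolz_sym \<alpha> \<gamma> \<Longrightarrow> R z w = P z w"
    and z: "z \<in> ball 0 \<delta>" "z \<notin> \<real>" and w: "w \<in> ball 0 \<delta>" "w \<notin> \<real>"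
  shows "R z w = P z w"
proof -
  \<comment> \<open>The sign of \<open>s\<close> selects a half-plane; with \<open>s = Im z\<close>
    and \<open>s = Im w\<close> all four components are treated at once.\<close>
  define H where "H = (\<lambda>s. {z. s * Im z > 0})"
  have H: "open (H s)" "convex (H s)" "H s \<subseteq> - \<real>" for s
  proof -
    show "open (H s)" unfolding H_def by (intro open_Collect_less continuous_intros)
    have "H s = {z. inner (Complex 0 s) z > 0}" by (simp add: H_def inner_complex_def)
    then show "convex (H s)" by (simp add: convex_halfspace_gt)
    show "H s \<subseteq> - \<real>" by (auto simp: H_def complex_is_Real_iff)
  qed
  define S where "S = (\<lambda>s. ball 0 \<delta> \<inter> H s)"
  define U where "U = (\<lambda>s. stolz_sym \<alpha> \<gamma> \<inter> H s)"
  have S: "open (S s)" "connected (S s)" for s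
    unfolding S_def by (auto intro!: open_Int convex_connected convex_Int H)
  have "\<i> * of_real (sgn s * (\<gamma> / 2)) \<in> U s" if "s \<noteq> 0" for s
    using that \<alpha> \<gamma> by (auto simp: U_def H_def mem_stolz_sym_iff abs_mult sgn_if mult_less_0_iff)
  then have U: "s \<noteq> 0 \<Longrightarrow> U s \<noteq> {}" "open (U s)" "U s \<subseteq> S s" for s
    using ball open_Int[OF open_stolz_sym H(1)] by (blast, auto simp: U_def S_def)
  have mem: "x \<in> S (Im x)" "Im x \<noteq> 0" if "x \<in> ball 0 \<delta>" "x \<notin> \<real>" for x
    using that by (auto simp: S_def H_def complex_is_Real_iff zero_less_mult_iff)
  have sub: "S s \<subseteq> ball 0 \<delta>" "S s \<subseteq> - \<real>" for s using H(3) by (auto simp: S_def)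
  note sec = holomorphic2_on_sections[OF R]
  show ?thesis
  proof (rule separately_holomorphic_identity[where f = R and g = P and U = "U (Im z)" and V = "U (Im w)",
        OF S S U(2) U(1)[OF mem(2)[OF z]] U(3) U(2) U(1)[OF mem(2)[OF w]] U(3)])
    show "z \<in> S (Im z)" "w \<in> S (Im w)" using mem z w by auto
    show "R x y = P x y" if "x \<in> U (Im z)" "y \<in> U (Im w)" for x y
      using eq that by (auto simp: U_def)
    show "(\<lambda>x. R x y) holomorphic_on S (Im z)" if "y \<in> S (Im w)" for y
      using sec(1) sub that by (meson holomorphic_on_subset subsetD)
    show "R x holomorphic_on S (Im w)" if "x \<in> S (Im z)" for x
      using sec(2) sub that by (meson holomorphic_on_subset subsetD)
    show "(\<lambda>x. P x y) holomorphic_on S (Im z)" if "y \<in> S (Im w)" for y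
      using Pz sub that by (meson holomorphic_on_subset subsetD)
    show "P x holomorphic_on S (Im w)" if "x \<in> S (Im z)" for x
      using Pw sub that by (meson holomorphic_on_subset subsetD)
  qed
qed

subsection \<open>The semigroup at time zero\<close>

text \<open>The marginal limits are linear in the two-variable transform, so a scaling of the latter
  passes to the marginals by uniqueness of limits.\<close>

lemma bifree_R_marginals_scale:
  assumes \<mu>: "plane_law \<mu>" and \<nu>: "plane_law \<nu>"
    and R: "bifree_R_with \<nu> \<alpha> \<beta> R1 R2 R"
    and S: "bifree_R_with \<mu> \<alpha> \<beta> S1 S2 (\<lambda>z w. c * R z w)"
    and \<alpha>: "\<alpha> > 0" and \<beta>: "\<beta> > 0" and z: "z \<in> stolz_sym \<alpha> \<beta>"
  shows "S1 z = c * R1 z" and "S2 z = c * R2 z"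
proof -
  have z0: "z \<noteq> 0" using z by (auto simp: mem_stolz_sym_iff)
  note lims = bifree_R_marginal_limits[OF \<mu> S \<alpha> \<beta> z] bifree_R_marginal_limits[OF \<nu> R \<alpha> \<beta> z]
  have "z * S1 z = c * (z * R1 z)" "z * S2 z = c * (z * R2 z)"
    using LIMSEQ_unique[OF lims(1) tendsto_mult_left[OF lims(3)]]
      LIMSEQ_unique[OF lims(2) tendsto_mult_left[OF lims(4)]] by auto
  then show "S1 z = c * R1 z" "S2 z = c * R2 z" using z0 by auto
qed

text \<open>The order of quantifiers matters: \<open>r1\<close> and \<open>r2\<close> are fixed
  before the angle and the transforms \<open>R1\<close>, \<open>R2\<close>, so that they serve every
  choice of these.\<close>

lemma compactly_supported_R_near_origin:
  assumes \<nu>: "plane_law \<nu>" and "compactly_supported \<nu>"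
  obtains \<rho> M0 r1 r2 where "\<rho> > 0" "M0 > 0" "AE p in \<nu>. \<bar>fst p\<bar> \<le> M0 \<and> \<bar>snd p\<bar> \<le> M0"
    "r1 holomorphic_on ball 0 \<rho>" "r2 holomorphic_on ball 0 \<rho>"
    "\<And>z. z \<in> ball 0 \<rho> \<Longrightarrow> r1 (cnj z) = cnj (r1 z)" "\<And>z. z \<in> ball 0 \<rho> \<Longrightarrow> r2 (cnj z) = cnj (r2 z)"
    "\<And>\<alpha> \<beta> R1 R2 R. bifree_R_with \<nu> \<alpha> \<beta> R1 R2 R \<Longrightarrow> \<alpha> > 0 \<Longrightarrow> \<beta> > 0 \<Longrightarrow>
        \<exists>\<gamma>>0. \<gamma> \<le> \<beta> \<and> (\<forall>z\<in>stolz_sym \<alpha> \<gamma>. R1 z = r1 z \<and> R2 z = r2 z)"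
proof -
  obtain M0 where M0: "M0 > 0" "AE p in \<nu>. \<bar>fst p\<bar> \<le> M0 \<and> \<bar>snd p\<bar> \<le> M0"
    using compactly_supported_AE_bounded[OF assms] .
  note marg = real_distribution_marginals[OF \<nu>] AE_marginals_of_plane[OF \<nu> M0(2)]
  obtain \<rho>1 r1 where 1: "\<rho>1 > 0" "r1 holomorphic_on ball 0 \<rho>1"
    "\<And>z. z \<in> ball 0 \<rho>1 \<Longrightarrow> r1 (cnj z) = cnj (r1 z)"
    "\<And>\<alpha> \<beta> R. R_transform_on (marginal1 \<nu>) \<alpha> \<beta> R \<Longrightarrow> \<alpha> > 0 \<Longrightarrow> \<beta> > 0 \<Longrightarrow>
        \<exists>\<gamma>>0. \<gamma> \<le> \<beta> \<and> (\<forall>z\<in>stolz_sym \<alpha> \<gamma>. R z = r1 z)"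
    using analytic_R_transform[OF marg(1,3) M0(1)] by metis
  obtain \<rho>2 r2 where 2: "\<rho>2 > 0" "r2 holomorphic_on ball 0 \<rho>2"
    "\<And>z. z \<in> ball 0 \<rho>2 \<Longrightarrow> r2 (cnj z) = cnj (r2 z)"
    "\<And>\<alpha> \<beta> R. R_transform_on (marginal2 \<nu>) \<alpha> \<beta> R \<Longrightarrow> \<alpha> > 0 \<Longrightarrow> \<beta> > 0 \<Longrightarrow>
        \<exists>\<gamma>>0. \<gamma> \<le> \<beta> \<and> (\<forall>z\<in>stolz_sym \<alpha> \<gamma>. R z = r2 z)"
    using analytic_R_transform[OF marg(2,4) M0(1)] by metis
  show ?thesis
  proof (rule that[of "min \<rho>1 \<rho>2" M0 r1 r2])
    fix \<alpha> \<beta> R1 R2 R assume R: "bifree_R_with \<nu> \<alpha> \<beta> R1 R2 R" and \<alpha>: "\<alpha> > 0" and \<beta>: "\<beta> > 0"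
    obtain \<gamma>1 where \<gamma>1: "\<gamma>1 > 0" "\<gamma>1 \<le> \<beta>" "\<forall>z\<in>stolz_sym \<alpha> \<gamma>1. R1 z = r1 z"
      using 1(4)[OF _ \<alpha> \<beta>] R unfolding bifree_R_with_def by blast
    obtain \<gamma>2 where \<gamma>2: "\<gamma>2 > 0" "\<gamma>2 \<le> \<beta>" "\<forall>z\<in>stolz_sym \<alpha> \<gamma>2. R2 z = r2 z"
      using 2(4)[OF _ \<alpha> \<beta>] R unfolding bifree_R_with_def by blast
    have "stolz_sym \<alpha> (min \<gamma>1 \<gamma>2) \<subseteq> stolz_sym \<alpha> \<gamma>1" "stolz_sym \<alpha> (min \<gamma>1 \<gamma>2) \<subseteq> stolz_sym \<alpha> \<gamma>2"
      by (rule stolz_sym_mono; simp)+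
    then show "\<exists>\<gamma>>0. \<gamma> \<le> \<beta> \<and> (\<forall>z\<in>stolz_sym \<alpha> \<gamma>. R1 z = r1 z \<and> R2 z = r2 z)"
      using \<gamma>1 \<gamma>2 by (intro exI[of _ "min \<gamma>1 \<gamma>2"]) auto
  next
    show "r1 holomorphic_on ball 0 (min \<rho>1 \<rho>2)" "r2 holomorphic_on ball 0 (min \<rho>1 \<rho>2)"
      using 1(2) 2(2) by (auto intro: holomorphic_on_subset)
  qed (use M0 1(1,3) 2(1,3) in auto)
qed

text \<open>\<open>R\<close> is constrained only off the real axes, so at the other points of the
  bidisk its value is that of the continuation \<open>P\<close>. The integrability clauses rule out
  the default value 0 of a Bochner integral in the difference quotient.\<close>

theorem proposition4p1:
  fixes \<nu> :: "(real \<times> real) measure"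
    and \<nu>t :: "real \<Rightarrow> (real \<times> real) measure"
    and R :: "complex \<Rightarrow> complex \<Rightarrow> complex"
  assumes "\<nu> \<in> BID"
    and "compactly_supported \<nu>"
    and "bifree_R_ext \<nu> R"
    and "bifree_semigroup \<nu> \<nu>t"
  shows "\<exists>r>0. \<exists>(c :: nat \<Rightarrow> nat \<Rightarrow> complex) (P :: complex \<Rightarrow> complex \<Rightarrow> complex).
    (\<forall>z w. cmod z < r \<and> cmod w < r \<longrightarrow>
       (\<lambda>(m, n). cmod (c m n * z ^ m * w ^ n)) summable_on UNIV \<and>
       ((\<lambda>(m, n). c m n * z ^ m * w ^ n) has_sum P z w) UNIV) \<and>
    (\<forall>z w. cmod z < r \<and> cmod w < r \<and> z \<notin> \<real> \<and> w \<notin> \<real> \<longrightarrow> R z w = P z w) \<and>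
    (\<forall>z w. cmod z < r \<and> cmod w < r \<and> (z, w) \<noteq> (0, 0) \<longrightarrow>
       integrable (\<nu>t 0) (cauchy2_inv_integrand z w) \<and>
       (\<forall>\<^sub>F t in at_right 0. integrable (\<nu>t t) (cauchy2_inv_integrand z w)) \<and>
       ((\<lambda>t. (cauchy2_inv (\<nu>t t) z w - cauchy2_inv (\<nu>t 0) z w) / of_real t)
          \<longlongrightarrow> z * w * P z w) (at_right 0))"
proof -
  have \<nu>: "plane_law \<nu>" using assms(1) by (simp add: BID_def)
  obtain \<rho> M0 r1 r2 where \<rho>: "\<rho> > 0" and M0: "M0 > 0" "AE p in \<nu>. \<bar>fst p\<bar> \<le> M0 \<and> \<bar>snd p\<bar> \<le> M0"
    and r: "r1 holomorphic_on ball 0 \<rho>" "r2 holomorphic_on ball 0 \<rho>"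
    and cnj1: "\<And>z. z \<in> ball 0 \<rho> \<Longrightarrow> r1 (cnj z) = cnj (r1 z)"
    and cnj2: "\<And>z. z \<in> ball 0 \<rho> \<Longrightarrow> r2 (cnj z) = cnj (r2 z)"
    and local: "\<And>\<alpha> \<beta> R1 R2 R. bifree_R_with \<nu> \<alpha> \<beta> R1 R2 R \<Longrightarrow> \<alpha> > 0 \<Longrightarrow> \<beta> > 0 \<Longrightarrow>
        \<exists>\<gamma>>0. \<gamma> \<le> \<beta> \<and> (\<forall>z\<in>stolz_sym \<alpha> \<gamma>. R1 z = r1 z \<and> R2 z = r2 z)"
    using compactly_supported_R_near_origin[OF \<nu> assms(2)] by blast
  obtain M1 where M1: "M1 > 0" "\<And>m t \<alpha> \<beta> R. real_distribution m \<Longrightarrow> 0 \<le> t \<Longrightarrow> t \<le> 1 \<Longrightarrow> \<alpha> > 0 \<Longrightarrow> \<beta> > 0 \<Longrightarrow>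
      R_transform_on m \<alpha> \<beta> R \<Longrightarrow> (\<And>z. z \<in> stolz_sym \<alpha> \<beta> \<Longrightarrow> R z = of_real t * r1 z) \<Longrightarrow> AE x in m. \<bar>x\<bar> \<le> M1"
    using support_bound_of_R_transform[OF \<rho> r(1) cnj1] by blast
  obtain M2 where M2: "M2 > 0" "\<And>m t \<alpha> \<beta> R. real_distribution m \<Longrightarrow> 0 \<le> t \<Longrightarrow> t \<le> 1 \<Longrightarrow> \<alpha> > 0 \<Longrightarrow> \<beta> > 0 \<Longrightarrow>
      R_transform_on m \<alpha> \<beta> R \<Longrightarrow> (\<And>z. z \<in> stolz_sym \<alpha> \<beta> \<Longrightarrow> R z = of_real t * r2 z) \<Longrightarrow> AE x in m. \<bar>x\<bar> \<le> M2"
    using support_bound_of_R_transform[OF \<rho> r(2) cnj2] by blast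
  \<comment> \<open>\<open>M0\<close> bounds the support of \<open>\<nu>\<close>, while
    \<open>M1\<close> and \<open>M2\<close> bound the marginals of every \<open>\<nu>t t\<close>
    with \<open>t \<le> 1\<close>.\<close>
  define M where "M = max M0 (max M1 M2)"
  have M: "M > 0" "M0 \<le> M" "M1 \<le> M" "M2 \<le> M" using M0(1) by (auto simp: M_def)
  obtain \<delta>1 where \<delta>1: "\<delta>1 > 0" "\<delta>1 \<le> \<rho>" "\<And>z. z \<in> ball 0 \<delta>1 \<Longrightarrow> norm (z * r1 z) \<le> 1/16"
    using small_near_zero[OF r(1) \<rho>] by blast
  obtain \<delta>2 where \<delta>2: "\<delta>2 > 0" "\<delta>2 \<le> \<rho>" "\<And>z. z \<in> ball 0 \<delta>2 \<Longrightarrow> norm (z * r2 z) \<le> 1/16"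
    using small_near_zero[OF r(2) \<rho>] by blast
  \<comment> \<open>The three bounds give 1/16 for \<open>norm (z * r1 z)\<close>,
    \<open>norm (z * r2 z)\<close> and \<open>\<delta> * M\<close>, as
    \<open>bicauchy_kernel_bound\<close> requires.\<close>
  define \<delta> where "\<delta> = min (min \<delta>1 \<delta>2) (1 / (16 * M))"
  have \<delta>: "\<delta> > 0" using \<delta>1 \<delta>2 M by (simp add: \<delta>_def)
  have "\<delta> * M \<le> 1 / (16 * M) * M" using M by (intro mult_right_mono) (auto simp: \<delta>_def)
  then have \<delta>M: "\<delta> * M \<le> 1/16" using M by simp
  have "ball 0 \<delta> \<subseteq> ball (0::complex) \<rho>" using \<delta>1 by (intro subset_ball) (auto simp: \<delta>_def)
  then have h1: "r1 holomorphic_on ball 0 \<delta>" and h2: "r2 holomorphic_on ball 0 \<delta>"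
    using r holomorphic_on_subset by blast+
  have h1: "r1 holomorphic_on ball 0 \<delta>" "\<And>z. z \<in> ball 0 \<delta> \<Longrightarrow> norm (z * r1 z) \<le> 1/16"
    using h1 \<delta>1(3) by (auto simp: \<delta>_def simp del: norm_mult)
  have h2: "r2 holomorphic_on ball 0 \<delta>" "\<And>z. z \<in> ball 0 \<delta> \<Longrightarrow> norm (z * r2 z) \<le> 1/16"
    using h2 \<delta>2(3) by (auto simp: \<delta>_def simp del: norm_mult)
  have supp\<nu>: "AE p in \<nu>. \<bar>fst p\<bar> \<le> M \<and> \<bar>snd p\<bar> \<le> M"
    using M0(2) by eventually_elim (use M in auto)

  \<comment> \<open>Continuation of the bi-free R-transform to a bidisk\<close>
  define H where "H = (\<lambda>z w. bicauchy \<nu> (1 + z * r1 z) (1 + w * r2 w) z w)"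
  define P where "P = (\<lambda>z w. z * r1 z + w * r2 w + (1 - 1 / H z w))"
  have a1: "(\<lambda>z. 1 + z * r1 z) holomorphic_on ball 0 \<delta>" "(\<lambda>z. 1 + z * r2 z) holomorphic_on ball 0 \<delta>"
    by (intro holomorphic_intros h1 h2)+
  have a2: "norm (1 + z * r1 z - 1) \<le> 1/16" "norm (1 + z * r2 z - 1) \<le> 1/16" if "z \<in> ball 0 \<delta>" for z
    using h1(2)[OF that] h2(2)[OF that] by simp_all
  have H_near_1: "norm (H z w - 1) \<le> 1/2" if "z \<in> ball 0 \<delta>" "w \<in> ball 0 \<delta>" for z w
    unfolding H_def
    by (rule norm_bicauchy_minus_1[OF \<nu> supp\<nu> \<delta>M less_imp_le[OF M(1)] a1(1) a2(1) a1(2) a2(2) that])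
  have H_hol: "w \<in> ball 0 \<delta> \<Longrightarrow> (\<lambda>z. H z w) holomorphic_on ball 0 \<delta>"
      "z \<in> ball 0 \<delta> \<Longrightarrow> H z holomorphic_on ball 0 \<delta>" for z w
    unfolding H_def
    by (rule holomorphic_bicauchy[OF \<nu> supp\<nu> \<delta>M less_imp_le[OF M(1)] a1(1) a2(1) a1(2) a2(2)]; assumption)+
  have H_ge: "norm (H z w) \<ge> 1/2" if "z \<in> ball 0 \<delta>" "w \<in> ball 0 \<delta>" for z w
    using H_near_1[OF that] norm_triangle_ineq2[of 1 "1 - H z w"] by (simp add: norm_minus_commute)
  then have H_nz: "H z w \<noteq> 0" if "z \<in> ball 0 \<delta>" "w \<in> ball 0 \<delta>" for z w using that by fastforce
  have Pz: "(\<lambda>z. P z w) holomorphic_on ball 0 \<delta>" if w: "w \<in> ball 0 \<delta>" for w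
    unfolding P_def using H_nz w by (intro holomorphic_intros h1 H_hol) auto
  have Pw: "P z holomorphic_on ball 0 \<delta>" if z: "z \<in> ball 0 \<delta>" for z
    unfolding P_def using H_nz z H_hol(2)[OF z] by (intro holomorphic_intros h2) auto
  \<comment> \<open>The terms contribute at most \<open>1/16 + 1/16 + 1 + 2\<close>, the last
    because \<open>norm (H z w) \<ge> 1/2\<close>.\<close>
  have Pb: "norm (P z w) \<le> 4" if z: "z \<in> ball 0 \<delta>" and w: "w \<in> ball 0 \<delta>" for z w
  proof -
    have "norm (1 / H z w) \<le> 1 / (1/2)" unfolding norm_divide using H_ge[OF z w] by (intro frac_le) auto
    moreover have "norm (P z w) \<le> norm (z * r1 z) + norm (w * r2 w) + (norm (1::complex) + norm (1 / H z w))"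
      unfolding P_def by (intro order_trans[OF norm_triangle_ineq] add_mono norm_triangle_ineq norm_triangle_ineq4)
    ultimately show ?thesis using h1(2)[OF z] h2(2)[OF w] by (simp del: norm_mult)
  qed

  \<comment> \<open>Stated for every \<open>R\<close>, since it is applied both to the given
    extension and to the one that comes with the semigroup, which need not be the same
    function.\<close>
  have R_eq_P: "\<exists>\<gamma>>0. \<gamma> \<le> \<beta> \<and> stolz_sym \<alpha> \<gamma> \<subseteq> ball 0 \<delta> \<and>
      (\<forall>z\<in>stolz_sym \<alpha> \<gamma>. R1 z = r1 z \<and> R2 z = r2 z) \<and>
      (\<forall>z\<in>stolz_sym \<alpha> \<gamma>. \<forall>w\<in>stolz_sym \<alpha> \<gamma>. R z w = P z w)"
    if R: "bifree_R_with \<nu> \<alpha> \<beta> R1 R2 R" and \<alpha>: "\<alpha> > 0" and \<beta>: "\<beta> > 0" for \<alpha> \<beta> R1 R2 R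
  proof -
    obtain \<gamma>1 where \<gamma>1: "\<gamma>1 > 0" "\<gamma>1 \<le> \<beta>" "\<forall>z\<in>stolz_sym \<alpha> \<gamma>1. R1 z = r1 z \<and> R2 z = r2 z"
      using local[OF R \<alpha> \<beta>] by blast
    obtain \<gamma> where \<gamma>: "\<gamma> > 0" "\<gamma> \<le> \<gamma>1" and ball: "stolz_sym \<alpha> \<gamma> \<subseteq> ball 0 \<delta>"
      using stolz_sym_subset_ball[OF \<alpha> \<gamma>1(1) \<delta>] .
    have sub: "stolz_sym \<alpha> \<gamma> \<subseteq> stolz_sym \<alpha> \<gamma>1" using \<gamma> by (intro stolz_sym_mono) auto
    have R': "bifree_R_with \<nu> \<alpha> \<gamma> R1 R2 R" using bifree_R_with_mono[OF R] \<gamma> \<gamma>1 by simp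
    have "R z w = P z w" if "z \<in> stolz_sym \<alpha> \<gamma>" "w \<in> stolz_sym \<alpha> \<gamma>" for z w
      using bifree_R_with_eq_bicauchy(2)[of \<nu> \<alpha> \<gamma> R1 R2 R z w 1 r1 r2, OF R' that] \<gamma>1(3) sub that
      by (auto simp: P_def H_def)
    then show ?thesis using \<gamma> \<gamma>1 ball sub by (intro exI[of _ \<gamma>]) auto
  qed

  from assms(3) obtain \<alpha> \<beta> where ext: "holomorphic2_on R ((- \<real>) \<times> (- \<real>))"
    and \<alpha>\<beta>: "\<alpha> > 0" "\<beta> > 0" "bifree_R_on \<nu> \<alpha> \<beta> R" unfolding bifree_R_ext_def by blast
  then obtain \<gamma> where "\<gamma> > 0" "stolz_sym \<alpha> \<gamma> \<subseteq> ball 0 \<delta>"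
      "\<And>z w. z \<in> stolz_sym \<alpha> \<gamma> \<Longrightarrow> w \<in> stolz_sym \<alpha> \<gamma> \<Longrightarrow> R z w = P z w"
    using R_eq_P unfolding bifree_R_on_iff by meson
  then have RP: "R z w = P z w" if "z \<in> ball 0 \<delta>" "z \<notin> \<real>" "w \<in> ball 0 \<delta>" "w \<notin> \<real>" for z w
    using extension_eq_near_origin[OF ext Pz Pw \<alpha>\<beta>(1)] that by blast

  \<comment> \<open>Uniform control of the semigroup for \<open>0 \<le> t \<le> 1\<close>\<close>
  from assms(4) obtain R' where R': "bifree_R_ext \<nu> R'"
    and BIDt: "\<And>t. t \<ge> 0 \<Longrightarrow> \<nu>t t \<in> BID"
    and Rt: "\<And>t. t \<ge> 0 \<Longrightarrow> bifree_R_ext (\<nu>t t) (\<lambda>z w. of_real t * R' z w)"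
    unfolding bifree_semigroup_def by blast
  have lawt: "plane_law (\<nu>t t)" if "t \<ge> 0" for t using BIDt[OF that] by (simp add: BID_def)
  have semigroup: "(AE p in \<nu>t t. \<bar>fst p\<bar> \<le> M \<and> \<bar>snd p\<bar> \<le> M) \<and>
      (\<forall>z\<in>ball 0 \<delta>. \<forall>w\<in>ball 0 \<delta>. bicauchy (\<nu>t t) (1 + of_real t * (z * r1 z)) (1 + of_real t * (w * r2 w)) z w
        * (1 + of_real t * (z * r1 z + w * r2 w - P z w)) = 1)"
    if t: "0 \<le> t" "t \<le> 1" for t
  proof -
    obtain \<alpha>1 \<beta>1 T1 T2 where T: "\<alpha>1 > 0" "\<beta>1 > 0" "bifree_R_with \<nu> \<alpha>1 \<beta>1 T1 T2 R'"
      using R' unfolding bifree_R_ext_def bifree_R_on_iff by blast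
    obtain \<alpha>2 \<beta>2 S1 S2 where S: "\<alpha>2 > 0" "\<beta>2 > 0"
        "bifree_R_with (\<nu>t t) \<alpha>2 \<beta>2 S1 S2 (\<lambda>z w. of_real t * R' z w)"
      using Rt[OF t(1)] unfolding bifree_R_ext_def bifree_R_on_iff by blast
    \<comment> \<open>The transforms of \<open>\<nu>\<close> and of \<open>\<nu>t t\<close> come
      with separate angles. The common one may shrink with \<open>t\<close>, whereas
      \<open>M\<close> and \<open>\<delta>\<close> are already fixed.\<close>
    define \<alpha> where "\<alpha> = min \<alpha>1 \<alpha>2"
    define \<beta> where "\<beta> = min \<beta>1 \<beta>2"
    have \<alpha>\<beta>: "\<alpha> > 0" "\<beta> > 0" using T S by (auto simp: \<alpha>_def \<beta>_def)
    have T': "bifree_R_with \<nu> \<alpha> \<beta> T1 T2 R'"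
      by (rule bifree_R_with_mono[OF T(3)]) (auto simp: \<alpha>_def \<beta>_def)
    obtain \<gamma> where \<gamma>: "\<gamma> > 0" "\<gamma> \<le> \<beta>"
      and T12: "\<And>z. z \<in> stolz_sym \<alpha> \<gamma> \<Longrightarrow> T1 z = r1 z \<and> T2 z = r2 z"
      and R'P: "\<And>z w. z \<in> stolz_sym \<alpha> \<gamma> \<Longrightarrow> w \<in> stolz_sym \<alpha> \<gamma> \<Longrightarrow> R' z w = P z w"
      using R_eq_P[OF T' \<alpha>\<beta>] by blast
    have T': "bifree_R_with \<nu> \<alpha> \<gamma> T1 T2 R'"
      using bifree_R_with_mono[OF T'] \<gamma> by simp
    have S': "bifree_R_with (\<nu>t t) \<alpha> \<gamma> S1 S2 (\<lambda>z w. of_real t * R' z w)"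
      by (rule bifree_R_with_mono[OF S(3)]) (use \<gamma> in \<open>auto simp: \<alpha>_def \<beta>_def\<close>)
    have S12: "S1 z = of_real t * r1 z" "S2 z = of_real t * r2 z" if z: "z \<in> stolz_sym \<alpha> \<gamma>" for z
      using bifree_R_marginals_scale[OF lawt[OF t(1)] \<nu> T' S' \<alpha>\<beta>(1) \<gamma>(1) z] T12[OF z] by auto
    have SP: "bifree_R_with (\<nu>t t) \<alpha> \<gamma> S1 S2 (\<lambda>z w. of_real t * P z w)"
      using S' R'P by (simp add: bifree_R_with_def)
    have Str: "R_transform_on (marginal1 (\<nu>t t)) \<alpha> \<gamma> S1" "R_transform_on (marginal2 (\<nu>t t)) \<alpha> \<gamma> S2"
      using S' by (auto simp: bifree_R_with_def)
    note marg = real_distribution_marginals[OF lawt[OF t(1)]]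
    have supp: "AE p in \<nu>t t. \<bar>fst p\<bar> \<le> M \<and> \<bar>snd p\<bar> \<le> M"
      by (rule AE_plane_of_marginals[OF lawt[OF t(1)] M1(2)[OF marg(1) t \<alpha>\<beta>(1) \<gamma>(1) Str(1) S12(1)]
            M2(2)[OF marg(2) t \<alpha>\<beta>(1) \<gamma>(1) Str(2) S12(2)] M(3,4)])
    show ?thesis
      using supp bicauchy_relation[OF \<delta> lawt[OF t(1)] supp \<delta>M less_imp_le[OF M(1)] h1 h2 Pz Pw t \<alpha>\<beta>(1) \<gamma>(1) SP S12]
      by blast
  qed

  \<comment> \<open>Passage to the Cauchy transform at inverted arguments\<close>
  have one: "(\<lambda>_. 1) holomorphic_on ball 0 \<delta>" "norm (1 - 1 :: complex) \<le> 1/16" by auto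
  have integrable: "integrable (\<nu>t t) (cauchy2_inv_integrand z w)"
    if t: "0 \<le> t" "t \<le> 1" and z: "z \<in> ball 0 \<delta>" and w: "w \<in> ball 0 \<delta>" for t z w
  proof -
    have "integrable (\<nu>t t) (\<lambda>p. 1 / ((1 - z * of_real (fst p)) * (1 - w * of_real (snd p))))"
      using bicauchy_integrable[OF lawt[OF t(1)] _ \<delta>M less_imp_le[OF M(1)] one one z w] semigroup[OF t] by blast
    then have "integrable (\<nu>t t) (\<lambda>p. z * w * (1 / ((1 - z * of_real (fst p)) * (1 - w * of_real (snd p)))))"
      by (rule integrable_mult_right)
    then show ?thesis by (simp add: cauchy2_inv_integrand_def case_prod_unfold)
  qed

  have nz: "1 + of_real t * c \<noteq> 0" if "0 \<le> t" "t \<le> 1" "norm c \<le> 1/16" for t :: real and c :: complex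
  proof
    assume "1 + of_real t * c = 0"
    then have "norm (of_real t * c) = 1" by (metis add.commute add_eq_0_iff norm_minus_cancel norm_one)
    moreover have "norm (of_real t * c) \<le> 1 * (1/16)"
      unfolding norm_mult using that by (intro mult_mono) auto
    ultimately show False by simp
  qed
  have rel: "bicauchy (\<nu>t t) 1 1 (z / (1 + of_real t * (z * r1 z))) (w / (1 + of_real t * (w * r2 w)))
        * (1 + of_real t * (z * r1 z + w * r2 w - P z w))
      = (1 + of_real t * (z * r1 z)) * (1 + of_real t * (w * r2 w))"
    if "0 \<le> t" "t \<le> 1" "z \<in> ball 0 \<delta>" "w \<in> ball 0 \<delta>" for t z w
    using semigroup[OF that(1,2)] that bicauchy_rescale[OF nz nz, OF that(1,2) h1(2) that(1,2) h2(2)]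
    by (simp add: mult.assoc del: norm_mult)
  have hol: "(\<lambda>z. z * r1 z) holomorphic_on ball 0 \<delta>" "(\<lambda>z. z * r2 z) holomorphic_on ball 0 \<delta>"
    by (intro holomorphic_intros h1 h2)+
  have main: "((\<lambda>t. (cauchy2_inv (\<nu>t t) z w - cauchy2_inv (\<nu>t 0) z w) / of_real t)
      \<longlongrightarrow> z * w * P z w) (at_right 0)" if z: "z \<in> ball 0 (\<delta>/4)" and w: "w \<in> ball 0 (\<delta>/4)" for z w
  proof -
    note deriv = rescaled_relation_derivative[of \<delta> "\<lambda>z. z * r1 z" "\<lambda>z. z * r2 z" P 4
        "\<lambda>t. bicauchy (\<nu>t t) 1 1", OF \<delta> hol(1) h1(2) hol(2) h2(2) Pz Pw Pb rel z w]
    have "((\<lambda>t. z * w * ((bicauchy (\<nu>t t) 1 1 z w - 1) / of_real t)) \<longlongrightarrow> z * w * P z w) (at_right 0)"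
      by (intro tendsto_mult_left deriv(2))
    moreover have "bicauchy (\<nu>t 0) 1 1 z w = 1" by (rule deriv(1))
    ultimately show ?thesis by (simp add: cauchy2_inv_eq_bicauchy right_diff_distrib)
  qed

  \<comment> \<open>The final radius is the one imposed by
    \<open>rescaled_relation_derivative\<close>, whose fixed points need room inside the bidisk of
    radius \<open>\<delta>\<close>.\<close>
  have "0 < \<delta>/4" "\<delta>/4 < \<delta>" using \<delta> by auto
  then obtain c where c: "\<And>z w. norm z < \<delta>/4 \<Longrightarrow> norm w < \<delta>/4 \<Longrightarrow>
      (\<lambda>(m, n). norm (c m n * z ^ m * w ^ n)) summable_on UNIV \<and>
      ((\<lambda>(m, n). c m n * z ^ m * w ^ n) has_sum P z w) UNIV"
    using double_power_series[OF _ _ Pz Pw Pb] by blast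
  have "eventually (\<lambda>t::real. 0 \<le> t \<and> t \<le> 1) (at_right 0)"
    by (intro eventually_at_rightI[of 0 1]) auto
  then have ev: "\<forall>\<^sub>F t in at_right 0. integrable (\<nu>t t) (cauchy2_inv_integrand z w)"
    if "z \<in> ball 0 \<delta>" "w \<in> ball 0 \<delta>" for z w
    by eventually_elim (use integrable that in auto)
  have sub: "x \<in> ball 0 \<delta>" "x \<in> ball 0 (\<delta>/4)" if "cmod x < \<delta>/4" for x using that \<delta> by auto
  show ?thesis
    by (intro exI[of _ "\<delta>/4"] exI[of _ c] exI[of _ P] conjI allI impI)
       (use \<delta> c RP integrable[of 0] ev main sub in auto)
qed

end
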